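(* Let $\Omega\subseteq\mathbb{R}^n$ be a simply connected open set, and let $\mathcal{U}$ be a covering of $\Omega$ consisting of path-connected open subsets of $\Omega$. For each $U\in\mathcal{U}$ let $F_U\in\mathcal{D}'(U)$ be a distribution. Suppose that for all $U,V\in\mathcal{U}$ with $U\cap V\neq\varnothing$ the restriction of $F_V-F_U$ to $\mathcal{D}(U\cap V)$, an element of $\mathcal{D}'(U\cap V)$, is generated by a constant function. Then there exist a mapping $C\colon\mathcal{U}\to\mathbb{K}$, $U\mapsto C_U$, and a distribution $F\in\mathcal{D}'(\Omega)$ such that $F_U=F+C_U$ on $\mathcal{D}(U)$ for all $U\in\mathcal{U}$.
   Context: $\mathbb{K}$ denotes the field of real or complex numbers ($\mathbb{K}=\mathbb{R}$ or $\mathbb{K}=\mathbb{C}$). For an open set $U\subseteq\mathbb{R}^n$, $\mathcal{D}(U)$ is the space of ($\mathbb{K}$-valued) test functions on $U$, i.e. infinitely differentiable functions with compact support in $U$, and $\mathcal{D}'(U)$ is the space of distributions on $U$. For open $W\subseteq U$, $\mathcal{D}(W)$ is regarded as a subspace of $\mathcal{D}(U)$ via extension by zero, and distributions on $U$ are restricted to $\mathcal{D}(W)$ accordingly. A constant $c\in\mathbb{K}$ also stands for the distribution generated by the constant function $c$, namely $\varphi\mapsto\int_U c\,\varphi(x)\,\mathrm{d}x$; thus $F_U=F+C_U$ on $\mathcal{D}(U)$ means $\langle F_U,\varphi\rangle=\langle F,\varphi\rangle+\int_U C_U\varphi(x)\,\mathrm{d}x$ for all $\varphi\in\mathcal{D}(U)$.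 Simply connected has its standard meaning (path-connected, and any two paths with the same endpoints are homotopic with fixed endpoints). *)

theory Defs
  imports "HOL-Analysis.Analysis"
begin

text \<open>
  The scalar field is a type \<open>'k :: {real_normed_field, euclidean_space}\<close>. Both \<^typ>\<open>real\<close> and
  \<^typ>\<open>complex\<close> are instances, and up to isometric isomorphism of real algebras there are no
  others (finite-dimensional commutative real division algebras, with a multiplicative norm).
\<close>

definition partial_derivative ::
    "'n \<Rightarrow> (real ^ 'n \<Rightarrow> 'k::real_normed_vector) \<Rightarrow> real ^ 'n \<Rightarrow> 'k"
  where "partial_derivative i f x = frechet_derivative f (at x) (axis i 1)"

text \<open>
  Iterated partial derivatives are indexed by lists of coordinate directions instead of
  multi-indices: the list \<open>[i\<^sub>1, \<dots>, i\<^sub>k]\<close> stands for the derivative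
  \<open>\<partial>\<^sub>i\<^sub>1 \<dots> \<partial>\<^sub>i\<^sub>k\<close> of order \<open>k\<close>. For smooth functions
  the order of the entries does not matter.
\<close>

definition iterated_partial ::
    "'n list \<Rightarrow> (real ^ 'n \<Rightarrow> 'k::real_normed_vector) \<Rightarrow> real ^ 'n \<Rightarrow> 'k"
  where "iterated_partial is f = foldr partial_derivative is f"

definition smooth :: "(real ^ 'n \<Rightarrow> 'k::real_normed_vector) \<Rightarrow> bool"
  where "smooth f \<longleftrightarrow> (\<forall>is x. iterated_partial is f differentiable (at x))"

definition supp :: "(real ^ 'n \<Rightarrow> 'k::real_normed_vector) \<Rightarrow> (real ^ 'n) set"
  where "supp f = closure {x. f x \<noteq> 0}"

text \<open>
  A test function on \<open>U\<close> is represented by its extension by zero to the whole space. Hence for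
  \<open>W \<subseteq> U\<close> the test functions on \<open>W\<close> form a subset of those on \<open>U\<close>, and a functional on the
  latter is restricted to the former by evaluating it there only.
\<close>

definition test_functions :: "(real ^ 'n) set \<Rightarrow> (real ^ 'n \<Rightarrow> 'k::real_normed_vector) set"
  where "test_functions U = {\<phi>. smooth \<phi> \<and> compact (supp \<phi>) \<and> supp \<phi> \<subseteq> U}"

lemma test_functions_mono: "W \<subseteq> U \<Longrightarrow> test_functions W \<subseteq> test_functions U"
  by (auto simp: test_functions_def)

definition Ck_norm :: "nat \<Rightarrow> (real ^ 'n \<Rightarrow> 'k::real_normed_vector) \<Rightarrow> real"
  where "Ck_norm k \<phi> =
    (\<Sum>is | length is \<le> k. SUP x. norm (iterated_partial is \<phi> x))"

text \<open>
  Distributions are the linear functionals on the test functions on \<open>U\<close> that satisfy, on each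
  compact \<open>K \<subseteq> U\<close>, an estimate by finitely many derivatives; this is continuity for the usual
  inductive limit topology. Values at functions other than test functions on \<open>U\<close> are
  unconstrained and irrelevant.
\<close>

definition distributions ::
    "(real ^ 'n) set \<Rightarrow> ((real ^ 'n \<Rightarrow> 'k::{real_normed_field,euclidean_space}) \<Rightarrow> 'k) set"
  where "distributions U = {T.
    (\<forall>\<phi>\<in>test_functions U. \<forall>\<psi>\<in>test_functions U. T (\<lambda>x. \<phi> x + \<psi> x) = T \<phi> + T \<psi>) \<and>
    (\<forall>c. \<forall>\<phi>\<in>test_functions U. T (\<lambda>x. c * \<phi> x) = c * T \<phi>) \<and>
    (\<forall>K. compact K \<and> K \<subseteq> U \<longrightarrow>
      (\<exists>B k. \<forall>\<phi>\<in>test_functions U. supp \<phi> \<subseteq> K \<longrightarrow> norm (T \<phi>) \<le> B * Ck_norm k \<phi>))}"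

definition const_distribution ::
    "(real ^ 'n) set \<Rightarrow> 'k \<Rightarrow> (real ^ 'n \<Rightarrow> 'k::{real_normed_field,euclidean_space}) \<Rightarrow> 'k"
  where "const_distribution U c \<phi> = (LINT x:U|lborel. c * \<phi> x)"

end

theory Submission
  imports Defs
begin

text \<open>
  The constants \<open>c U V\<close> with \<open>F V - F U = c U V\<close> on \<open>U \<inter> V\<close> form a cocycle, because a test function
  supported in \<open>U \<inter> V \<inter> W\<close> with nonzero integral detects constants. Choosing for every point \<open>x\<close> a
  member \<open>A x\<close> containing it turns the cocycle into increments \<open>\<delta> x y = c (A x) U + c U (A y)\<close>,
  which for \<open>x, y \<in> U\<close> do not depend on \<open>U\<close> and are additive inside each member. Such increments
  can be summed along paths; summing over a homotopy square shows that the result depends only on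
  the endpoints when \<open>\<Omega>\<close> is simply connected, and connectedness of the members yields
  \<open>h y - h x = \<delta> x y\<close> on each of them. Then \<open>C U = h x + c (A x) U\<close> is independent of \<open>x \<in> U\<close> and splits
  the cocycle, so the distributions \<open>F U - C U\<close> agree on overlaps and are glued by a partition of
  unity.
\<close>

section \<open>Smooth functions\<close>

lemma partial_derivative_eq:
  "(f has_derivative f') (at x) \<Longrightarrow> partial_derivative i f x = f' (axis i 1)"
  unfolding partial_derivative_def by (metis frechet_derivative_at)

lemma iterated_partial_Nil [simp]: "iterated_partial [] f = f"
  by (simp add: iterated_partial_def)

text \<open>\<open>foldr\<close> applies the last entry of the list first. Peeling lists from the
  right therefore replaces \<open>f\<close> by a partial derivative of \<open>f\<close>, which suits
  inductions that generalise over the function.\<close>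

lemma iterated_partial_snoc:
  "iterated_partial (is @ [i]) f = iterated_partial is (partial_derivative i f)"
  by (simp add: iterated_partial_def)

text \<open>A graded form of \<open>smooth\<close>, made for induction on the order. Order
  \<open>0\<close> already means differentiable everywhere; \<open>m\<close> counts the further
  derivatives that are again required to be differentiable.\<close>

definition smooth_upto :: "nat \<Rightarrow> (real ^ 'n \<Rightarrow> 'k::real_normed_vector) \<Rightarrow> bool"
  where "smooth_upto m f \<longleftrightarrow>
    (\<forall>is x. length is \<le> m \<longrightarrow> iterated_partial is f differentiable (at x))"

lemma smooth_iff_smooth_upto: "smooth f \<longleftrightarrow> (\<forall>m. smooth_upto m f)"
  unfolding smooth_def smooth_upto_def by blast

lemma smooth_upto_0: "smooth_upto 0 f \<longleftrightarrow> (\<forall>x. f differentiable (at x))"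
  by (simp add: smooth_upto_def)

lemma smooth_upto_Suc:
  "smooth_upto (Suc m) f \<longleftrightarrow>
    (\<forall>x. f differentiable (at x)) \<and> (\<forall>i. smooth_upto m (partial_derivative i f))"
proof -
  have "(\<forall>is. length is \<le> Suc m \<longrightarrow> P is) \<longleftrightarrow>
      P [] \<and> (\<forall>i is. length is \<le> m \<longrightarrow> P (is @ [i]))" for P :: "'a list \<Rightarrow> bool"
    by (metis Suc_le_mono le0 length_append_singleton list.size(3) rev_exhaust)
  from this[of "\<lambda>is. \<forall>x. iterated_partial is f differentiable (at x)"] show ?thesis
    unfolding smooth_upto_def by (simp add: iterated_partial_snoc)
qed

lemma smooth_upto_differentiable: "smooth_upto m f \<Longrightarrow> f differentiable (at x)"
  by (cases m) (auto simp: smooth_upto_0 smooth_upto_Suc)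

lemma smooth_upto_mono: "smooth_upto m f \<Longrightarrow> l \<le> m \<Longrightarrow> smooth_upto l f"
  unfolding smooth_upto_def by auto

text \<open>The common induction step for the closure properties: a formula for the derivative
  reduces order \<open>m\<close> to its values in the coordinate directions at order
  \<open>m - 1\<close>. For \<open>m = 0\<close> the second premise is vacuous.\<close>

lemma smooth_uptoI:
  assumes "\<And>x. (f has_derivative f' x) (at x)"
    and "\<And>l i. m = Suc l \<Longrightarrow> smooth_upto l (\<lambda>x. f' x (axis i 1))"
  shows "smooth_upto m f"
proof (cases m)
  case 0
  with assms(1) show ?thesis by (auto simp: smooth_upto_0 differentiable_def)
next
  case (Suc l)
  moreover have "partial_derivative i f = (\<lambda>x. f' x (axis i 1))" for i
    using assms(1) by (auto simp: partial_derivative_eq)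
  ultimately show ?thesis using assms by (auto simp: smooth_upto_Suc differentiable_def)
qed

lemma smooth_upto_const: "smooth_upto m (\<lambda>x. c)"
proof (induction m arbitrary: c)
  case (Suc m)
  show ?case by (rule smooth_uptoI[where f' = "\<lambda>_ _. 0"]) (auto simp: Suc.IH)
qed (simp add: smooth_upto_0)

lemma smooth_upto_linear: "bounded_linear f \<Longrightarrow> smooth_upto m f"
  by (rule smooth_uptoI[where f' = "\<lambda>_. f"])
    (auto simp: bounded_linear_imp_has_derivative smooth_upto_const)

lemma smooth_upto_has_derivative:
  "smooth_upto m f \<Longrightarrow> (f has_derivative frechet_derivative f (at x)) (at x)"
  by (simp add: smooth_upto_differentiable frechet_derivative_works[symmetric])

lemma smooth_upto_partial:
  "smooth_upto (Suc m) f \<Longrightarrow> smooth_upto m (\<lambda>x. frechet_derivative f (at x) (axis i 1))"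
  by (simp add: smooth_upto_Suc partial_derivative_def[abs_def])

lemma smooth_upto_add:
  "smooth_upto m f \<Longrightarrow> smooth_upto m g \<Longrightarrow> smooth_upto m (\<lambda>x. f x + g x)"
proof (induction m arbitrary: f g rule: less_induct)
  case (less m)
  show ?case
  proof (rule smooth_uptoI[OF has_derivative_add[OF less.prems[THEN smooth_upto_has_derivative]]])
    fix l i assume "m = Suc l"
    with less.prems show "smooth_upto l (\<lambda>x. frechet_derivative f (at x) (axis i 1) +
        frechet_derivative g (at x) (axis i 1))"
      by (intro less.IH smooth_upto_partial) auto
  qed
qed

text \<open>The product rule writes each partial derivative as a sum of products whose factors are
  smooth to the next lower order, so the induction generalises over both factors.\<close>

lemma smooth_upto_mult:
  fixes f g :: "real ^ 'n \<Rightarrow> 'k::real_normed_algebra"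
  shows "smooth_upto m f \<Longrightarrow> smooth_upto m g \<Longrightarrow> smooth_upto m (\<lambda>x. f x * g x)"
proof (induction m arbitrary: f g rule: less_induct)
  case (less m)
  show ?case
  proof (rule smooth_uptoI[OF has_derivative_mult[OF less.prems[THEN smooth_upto_has_derivative]]])
    fix l i assume m: "m = Suc l"
    with less.prems show "smooth_upto l (\<lambda>x. f x * frechet_derivative g (at x) (axis i 1) +
        frechet_derivative f (at x) (axis i 1) * g x)"
      using smooth_upto_mono[of m f l] smooth_upto_mono[of m g l]
      by (intro smooth_upto_add less.IH smooth_upto_partial) auto
  qed
qed

text \<open>The derivative of \<open>1 / f\<close> contains \<open>1 / f\<close> again, but only to
  the next lower order, where the induction hypothesis covers it.\<close>

lemma smooth_upto_inverse:
  fixes f :: "real ^ 'n \<Rightarrow> 'k::real_normed_field"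
  assumes "\<And>x. f x \<noteq> 0"
  shows "smooth_upto m f \<Longrightarrow> smooth_upto m (\<lambda>x. inverse (f x))"
proof (induction m rule: less_induct)
  case (less m)
  show ?case
  proof (rule smooth_uptoI)
    show "((\<lambda>x. inverse (f x)) has_derivative
        (\<lambda>h. - (inverse (f x) * frechet_derivative f (at x) h * inverse (f x)))) (at x)" for x
      by (rule Deriv.has_derivative_inverse[OF assms smooth_upto_has_derivative[OF less.prems]])
    fix l i assume m: "m = Suc l"
    have "smooth_upto l (\<lambda>x. inverse (f x))"
      using less.IH[of l] less.prems m smooth_upto_mono[of m f l] by auto
    moreover have "smooth_upto l (\<lambda>x. frechet_derivative f (at x) (axis i 1))"
      using less.prems m by (auto intro: smooth_upto_partial)
    ultimately have "smooth_upto l (\<lambda>x. (-1) *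
        (inverse (f x) * frechet_derivative f (at x) (axis i 1) * inverse (f x)))"
      by (intro smooth_upto_mult smooth_upto_const)
    then show "smooth_upto l (\<lambda>x. - (inverse (f x) * frechet_derivative f (at x) (axis i 1) * inverse (f x)))"
      by simp
  qed
qed

lemma smooth_upto_of_real:
  "smooth_upto m f \<Longrightarrow> smooth_upto m (\<lambda>x. of_real (f x) :: 'k::real_normed_field)"
proof (induction m arbitrary: f rule: less_induct)
  case (less m)
  show ?case
    by (rule smooth_uptoI[OF bounded_linear.has_derivative[OF bounded_linear_of_real
            smooth_upto_has_derivative[OF less.prems]]])
      (use less in \<open>auto intro!: less.IH smooth_upto_partial\<close>)
qed

section \<open>Flat functions built from \<open>exp (- 1 / x)\<close>\<close>

definition flat :: "nat \<Rightarrow> real \<Rightarrow> real"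
  where "flat k x = (if x > 0 then inverse x ^ k * exp (- inverse x) else 0)"

lemma flat_tendsto_0: "((\<lambda>x. inverse x ^ k * exp (- inverse x)) \<longlongrightarrow> (0::real)) (at_right 0)"
proof -
  have "((\<lambda>x::real. x ^ k / exp x) \<longlongrightarrow> 0) at_top"
    by (rule tendsto_power_div_exp_0)
  from filterlim_compose[OF this filterlim_inverse_at_top_right] show ?thesis
    by (simp add: exp_minus field_simps)
qed

text \<open>The powers of \<open>inverse x\<close> make the family closed under differentiation up
  to linear combinations. At \<open>0\<close> the difference quotient from the right is
  \<open>flat (k + 1)\<close>, which tends to \<open>0\<close>; from the left it vanishes.\<close>

lemma flat_has_derivative:
  "(flat k has_real_derivative flat (k + 2) x - k * flat (k + 1) x) (at x)"
proof -
  consider "x > 0" | "x < 0" | "x = 0" by linarith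
  then show ?thesis
  proof cases
    case 1
    have "((\<lambda>x. inverse x ^ k * exp (- inverse x)) has_real_derivative
        flat (k + 2) x - k * flat (k + 1) x) (at x)"
      using 1 by (auto intro!: derivative_eq_intros simp: flat_def)
        (cases k; simp add: field_simps power2_eq_square)
    then show ?thesis
      by (rule DERIV_cong_ev[THEN iffD1, OF refl _ refl, rotated])
        (use 1 eventually_nhds_in_open[of "{0<..}" x] in
          \<open>auto simp: flat_def elim!: eventually_mono\<close>)
  next
    case 2
    have "((\<lambda>x. 0) has_real_derivative flat (k + 2) x - k * flat (k + 1) x) (at x)"
      using 2 by (auto simp: flat_def)
    then show ?thesis
      by (rule DERIV_cong_ev[THEN iffD1, OF refl _ refl, rotated])
        (use 2 eventually_nhds_in_open[of "{..<0}" x] in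
          \<open>auto simp: flat_def elim!: eventually_mono\<close>)
  next
    case 3
    have "((\<lambda>h. (flat k h - flat k 0) / h) \<longlongrightarrow> 0) (at_right 0)"
      by (rule tendsto_cong[THEN iffD1, OF _ flat_tendsto_0[of "k + 1"]])
        (auto simp: flat_def eventually_at_right_less field_simps
          intro!: eventually_mono[OF eventually_at_right_less[of 0]])
    moreover have "((\<lambda>h. (flat k h - flat k 0) / h) \<longlongrightarrow> 0) (at_left 0)"
      by (rule tendsto_cong[THEN iffD1, OF _ tendsto_const[of 0]])
        (auto simp: flat_def intro!: eventually_mono[OF eventually_at_left_real[of "-1" 0]])
    ultimately show ?thesis
      using 3 filterlim_split_at[of "\<lambda>h. (flat k h - flat k 0) / h" "nhds 0" 0]
      by (simp add: DERIV_def) (simp add: flat_def)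
  qed
qed

text \<open>The chain rule brings in \<open>flat (k + 1)\<close> and \<open>flat (k + 2)\<close> at
  lower order; hence \<open>k\<close> is left arbitrary while \<open>f\<close> stays fixed.\<close>

lemma smooth_upto_flat:
  "smooth_upto m f \<Longrightarrow> smooth_upto m (\<lambda>x. flat k (f x))"
proof (induction m arbitrary: k rule: less_induct)
  case (less m)
  show ?case
  proof (rule smooth_uptoI)
    show "((\<lambda>x. flat k (f x)) has_derivative
        (\<lambda>h. frechet_derivative f (at x) h * (flat (k + 2) (f x) - k * flat (k + 1) (f x)))) (at x)" for x
      using DERIV_compose_FDERIV[OF flat_has_derivative smooth_upto_has_derivative[OF less.prems]] .
    fix l i assume m: "m = Suc l"
    have "smooth_upto l (\<lambda>x. frechet_derivative f (at x) (axis i 1) *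
        (flat (k + 2) (f x) + (- real k) * flat (k + 1) (f x)))"
      using less.prems m smooth_upto_mono[of m f l]
      by (intro smooth_upto_mult smooth_upto_add smooth_upto_const smooth_upto_partial less.IH) auto
    then show "smooth_upto l (\<lambda>x. frechet_derivative f (at x) (axis i 1) *
        (flat (k + 2) (f x) - k * flat (k + 1) (f x)))"
      by simp
  qed
qed

section \<open>Infinitely differentiable functions and plateaus\<close>

lemma smooth_add: "smooth f \<Longrightarrow> smooth g \<Longrightarrow> smooth (\<lambda>x. f x + g x)"
  by (simp add: smooth_iff_smooth_upto smooth_upto_add)

lemma smooth_mult:
  fixes f g :: "real ^ 'n \<Rightarrow> 'k::real_normed_algebra"
  shows "smooth f \<Longrightarrow> smooth g \<Longrightarrow> smooth (\<lambda>x. f x * g x)"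
  by (simp add: smooth_iff_smooth_upto smooth_upto_mult)

lemma smooth_const: "smooth (\<lambda>x. c)"
  by (simp add: smooth_iff_smooth_upto smooth_upto_const)

lemma smooth_diff:
  fixes f g :: "real ^ 'n \<Rightarrow> 'k::real_normed_field"
  assumes "smooth f" "smooth g"
  shows "smooth (\<lambda>x. f x - g x)"
  using smooth_add[OF assms(1) smooth_mult[OF smooth_const[of "-1"] assms(2)]] by simp

lemma smooth_sum:
  assumes "finite I" "\<And>i. i \<in> I \<Longrightarrow> smooth (f i)"
  shows "smooth (\<lambda>x. \<Sum>i\<in>I. f i x)"
  using assms by (induction I) (auto intro: smooth_add smooth_const)

lemma smooth_differentiable: "smooth f \<Longrightarrow> f differentiable (at x)"
  using smooth_iff_smooth_upto smooth_upto_differentiable by blast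

lemma smooth_continuous_on: "smooth f \<Longrightarrow> continuous_on S f"
  by (simp add: smooth_differentiable differentiable_imp_continuous_within continuous_at_imp_continuous_on)

lemma smooth_partial_derivative: "smooth f \<Longrightarrow> smooth (partial_derivative i f)"
  using smooth_iff_smooth_upto smooth_upto_Suc by blast

text \<open>The function is \<open>u / (u + v)\<close>, where \<open>u\<close> is positive exactly
  at distance less than \<open>2 * r\<close> from \<open>a\<close> and \<open>v\<close> exactly at
  distance greater than \<open>r\<close>. The two regions cover the space, so the denominator never
  vanishes.\<close>

lemma plateau_function:
  fixes a :: "real ^ 'n"
  assumes "r > 0"
  obtains \<eta> :: "real ^ 'n \<Rightarrow> real"
  where "\<And>m. smooth_upto m \<eta>" "\<And>x. 0 \<le> \<eta> x" "\<And>x. dist a x \<le> r \<Longrightarrow> \<eta> x = 1"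
    "\<And>x. dist a x \<ge> 2 * r \<Longrightarrow> \<eta> x = 0"
proof -
  \<comment> \<open>The squared distance is a polynomial in the coordinates and hence smooth also at
    \<open>a\<close>, unlike the distance itself.\<close>
  define q where "q x = (x - a) \<bullet> (x - a)" for x
  have q: "q x = (dist a x)\<^sup>2" for x
    by (simp add: q_def dist_norm power2_norm_eq_inner norm_minus_commute[of a])
  have q_eq: "q = (\<lambda>x. \<Sum>i\<in>UNIV. (x $ i + - (a $ i)) * (x $ i + - (a $ i)))"
    by (auto simp: q_def inner_vec_def)
  have sq: "smooth_upto m q" for m
  proof -
    have "smooth_upto m (\<lambda>x. (x $ i + - (a $ i)) * (x $ i + - (a $ i)))" for i
      by (intro smooth_upto_mult smooth_upto_add smooth_upto_const
          smooth_upto_linear[OF bounded_linear_vec_nth])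
    then have "smooth_upto m (\<lambda>x. \<Sum>i\<in>I. (x $ i + - (a $ i)) * (x $ i + - (a $ i)))" for I
      by (induction I rule: infinite_finite_induct) (auto intro: smooth_upto_const smooth_upto_add)
    then show ?thesis by (simp add: q_eq)
  qed
  \<comment> \<open>Differences are written as sums with \<open>(-1) * q x\<close> and
    \<open>- (r\<^sup>2)\<close> so that the closure rules for sums and products apply.\<close>
  define u where "u x = flat 0 ((2 * r)\<^sup>2 + (-1) * q x)" for x
  define v where "v x = flat 0 (q x + - (r\<^sup>2))" for x
  have su: "smooth_upto m u" and sv: "smooth_upto m v" for m
    unfolding u_def v_def
    by (intro smooth_upto_flat smooth_upto_add smooth_upto_mult smooth_upto_const sq)+
  have nn: "u x \<ge> 0" "v x \<ge> 0" for x by (auto simp: u_def v_def flat_def)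
  have v0: "v x = 0" "u x > 0" if "dist a x \<le> r" for x
  proof -
    have "q x \<le> r\<^sup>2" unfolding q using that by (intro power_mono) auto
    moreover from this have "q x < 4 * r\<^sup>2"
      using zero_less_power[OF assms, of 2] by linarith
    ultimately show "v x = 0" "u x > 0" by (auto simp: u_def v_def flat_def)
  qed
  have u0: "u x = 0" if "dist a x \<ge> 2 * r" for x
  proof -
    have "q x \<ge> (2 * r)\<^sup>2" unfolding q using that assms by (intro power_mono) auto
    then show "u x = 0" by (auto simp: u_def flat_def)
  qed
  have pos: "u x + v x > 0" for x
  proof (cases "dist a x \<le> r")
    case True
    with v0 nn(2)[of x] show ?thesis by (auto intro: add_pos_nonneg)
  next
    case False
    then have "q x > r\<^sup>2" unfolding q using assms by (intro power_strict_mono) auto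
    then have "v x > 0" by (auto simp: v_def flat_def)
    with nn(1)[of x] show ?thesis by linarith
  qed
  show thesis
  proof
    show "smooth_upto m (\<lambda>x. u x * inverse (u x + v x))" for m
      using pos by (intro smooth_upto_mult smooth_upto_inverse smooth_upto_add su sv) (metis less_irrefl)
  qed (use nn v0 u0 pos in \<open>auto simp: less_imp_neq[symmetric] intro: less_imp_le\<close>)
qed

section \<open>Test functions and gluing of distributions\<close>

lemma supp_mono: "(\<And>x. g x \<noteq> 0 \<Longrightarrow> f x \<noteq> 0) \<Longrightarrow> supp g \<subseteq> supp f"
  unfolding supp_def by (intro closure_mono) auto

lemma not_in_supp: "x \<notin> supp f \<Longrightarrow> f x = 0"
  using closure_subset[of "{x. f x \<noteq> 0}"] by (auto simp: supp_def)

lemma supp_zero [simp]: "supp (\<lambda>x. 0) = {}"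
  by (simp add: supp_def)

lemma supp_add: "supp (\<lambda>x. f x + g x) \<subseteq> supp f \<union> supp g"
  unfolding supp_def closure_Un[symmetric] by (intro closure_mono) auto

text \<open>The complement of the support is open and \<open>f\<close> vanishes on it, so
  \<open>f\<close> has zero derivative at each of its points.\<close>

lemma supp_partial_derivative: "supp (partial_derivative i f) \<subseteq> supp f"
proof -
  have "partial_derivative i f x = 0" if "x \<notin> supp f" for x
  proof -
    have "open (- supp f)" unfolding supp_def by (rule open_Compl[OF closed_closure])
    then have "(f has_derivative (\<lambda>_. 0)) (at x)"
      by (rule has_derivative_transform_within_open[OF has_derivative_const[of 0]])
        (use that in \<open>auto simp: not_in_supp\<close>)
    then show ?thesis by (simp add: partial_derivative_eq)
  qed
  then have "{x. partial_derivative i f x \<noteq> 0} \<subseteq> supp f" by blast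
  then show ?thesis
    by (metis closed_closure closure_minimal supp_def)
qed

lemma test_functions_smooth: "\<phi> \<in> test_functions U \<Longrightarrow> smooth \<phi>"
  by (simp add: test_functions_def)

lemma test_functions_iff: "\<phi> \<in> test_functions U \<longleftrightarrow> \<phi> \<in> test_functions UNIV \<and> supp \<phi> \<subseteq> U"
  by (auto simp: test_functions_def)

lemma test_functions_zero: "(\<lambda>x. 0) \<in> test_functions U"
  by (simp add: test_functions_def smooth_const)

lemma compact_supp_subset: "compact K \<Longrightarrow> supp f \<subseteq> K \<Longrightarrow> compact (supp f)"
  by (metis closed_closure compact_Int_closed inf.absorb2 supp_def)

lemma test_functions_add:
  assumes "\<phi> \<in> test_functions U" "\<psi> \<in> test_functions U"
  shows "(\<lambda>x. \<phi> x + \<psi> x) \<in> test_functions U"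
  using assms supp_add[of \<phi> \<psi>] compact_supp_subset[OF compact_Un supp_add[of \<phi> \<psi>]]
  by (auto simp: test_functions_def smooth_add)

lemma test_functions_sum:
  assumes "\<And>i. i \<in> I \<Longrightarrow> \<phi> i \<in> test_functions U"
  shows "(\<lambda>x. \<Sum>i\<in>I. \<phi> i x) \<in> test_functions U"
  using assms
  by (induction I rule: infinite_finite_induct) (auto intro: test_functions_add test_functions_zero)

lemma test_functions_smooth_mult:
  fixes \<rho> \<phi> :: "real ^ 'n \<Rightarrow> 'k::real_normed_field"
  assumes "smooth \<rho>" "\<phi> \<in> test_functions U"
  shows "(\<lambda>x. \<rho> x * \<phi> x) \<in> test_functions U"
proof -
  have "supp (\<lambda>x. \<rho> x * \<phi> x) \<subseteq> supp \<phi>" by (rule supp_mono) auto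
  then show ?thesis
    using assms compact_supp_subset by (auto simp: test_functions_def intro!: smooth_mult)
qed

text \<open>Either factor may serve as the smooth multiplier of the other, so the support lies in
  both sets. This places localised functions on overlaps of members.\<close>

lemma test_functions_mult:
  fixes \<rho> \<phi> :: "real ^ 'n \<Rightarrow> 'k::real_normed_field"
  assumes "\<rho> \<in> test_functions V" "\<phi> \<in> test_functions U"
  shows "(\<lambda>x. \<rho> x * \<phi> x) \<in> test_functions (V \<inter> U)"
  using test_functions_smooth_mult[OF test_functions_smooth[OF assms(1)] assms(2)]
    test_functions_smooth_mult[OF test_functions_smooth[OF assms(2)] assms(1)]
  by (auto simp: test_functions_def mult.commute)

lemma test_functions_partial_derivative:
  "\<phi> \<in> test_functions U \<Longrightarrow> partial_derivative i \<phi> \<in> test_functions U"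
  using supp_partial_derivative[of i \<phi>] compact_supp_subset[OF _ supp_partial_derivative[of i \<phi>]]
  by (auto simp: test_functions_def smooth_partial_derivative)

lemma test_functions_iterated_partial:
  "\<phi> \<in> test_functions U \<Longrightarrow> iterated_partial is \<phi> \<in> test_functions U"
  by (induction "is") (auto simp: iterated_partial_def intro: test_functions_partial_derivative)

text \<open>A continuous function with compact support is bounded. The suprema in
  \<open>Ck_norm\<close> are real suprema, so their estimates depend on this.\<close>

lemma test_functions_bounded:
  assumes "\<phi> \<in> test_functions U"
  shows "bdd_above (range (\<lambda>x. norm (\<phi> x)))"
proof -
  have "compact (\<phi> ` supp \<phi>)"
    using assms by (auto simp: test_functions_def intro!: compact_continuous_image smooth_continuous_on)
  then obtain B where B: "\<And>x. x \<in> supp \<phi> \<Longrightarrow> norm (\<phi> x) \<le> B"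
    by (metis bounded_iff compact_imp_bounded image_eqI)
  have "norm (\<phi> x) \<le> max B 0" for x
    using B[of x] not_in_supp[of x \<phi>] by fastforce
  then show ?thesis by (auto intro!: bdd_aboveI)
qed

section \<open>Estimates for \<open>Ck_norm\<close>\<close>

lemma finite_lists_upto: "finite {is :: 'n::finite list. length is \<le> k}"
  using finite_lists_length_le[of "UNIV :: 'n set" k] by simp

lemma SUP_norm_nonneg:
  assumes "\<phi> \<in> test_functions U"
  shows "0 \<le> (SUP x. norm (\<phi> x))"
  by (rule order_trans[OF norm_ge_zero cSUP_upper[OF UNIV_I test_functions_bounded[OF assms]]])

lemma norm_iterated_partial_le_Ck_norm:
  assumes "\<phi> \<in> test_functions U" "length is \<le> k"
  shows "norm (iterated_partial is \<phi> x) \<le> Ck_norm k \<phi>"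
proof -
  have "norm (iterated_partial is \<phi> x) \<le> (SUP x. norm (iterated_partial is \<phi> x))"
    using test_functions_bounded[OF test_functions_iterated_partial[OF assms(1)]]
    by (intro cSUP_upper) auto
  also have "\<dots> \<le> Ck_norm k \<phi>"
    unfolding Ck_norm_def using assms
    by (intro member_le_sum[where f = "\<lambda>is. SUP x. norm (iterated_partial is \<phi> x)"])
      (auto intro: SUP_norm_nonneg test_functions_iterated_partial finite_lists_upto)
  finally show ?thesis .
qed

lemma Ck_norm_nonneg: "\<phi> \<in> test_functions U \<Longrightarrow> 0 \<le> Ck_norm k \<phi>"
  unfolding Ck_norm_def by (intro sum_nonneg SUP_norm_nonneg test_functions_iterated_partial)

lemma Ck_norm_mono:
  assumes "\<phi> \<in> test_functions U" "k \<le> l"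
  shows "Ck_norm k \<phi> \<le> Ck_norm l \<phi>"
  unfolding Ck_norm_def using assms
  by (intro sum_mono2 finite_lists_upto SUP_norm_nonneg test_functions_iterated_partial) auto

text \<open>Appending \<open>i\<close> maps the lists of length at most \<open>k\<close> injectively
  into those of length at most \<open>Suc k\<close>; the left side is thus a partial sum of the
  nonnegative terms on the right.\<close>

lemma Ck_norm_partial_derivative:
  assumes "\<phi> \<in> test_functions U"
  shows "Ck_norm k (partial_derivative i \<phi>) \<le> Ck_norm (Suc k) \<phi>"
proof -
  let ?S = "\<lambda>is. SUP x. norm (iterated_partial is \<phi> x)"
  have "Ck_norm k (partial_derivative i \<phi>) = (\<Sum>is | length is \<le> k. ?S (is @ [i]))"
    by (simp add: Ck_norm_def iterated_partial_snoc)
  also have "\<dots> = sum ?S ((\<lambda>is. is @ [i]) ` {is. length is \<le> k})"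
    by (subst sum.reindex) (auto simp: inj_on_def)
  also have "\<dots> \<le> Ck_norm (Suc k) \<phi>"
    unfolding Ck_norm_def using assms
    by (intro sum_mono2 finite_lists_upto SUP_norm_nonneg test_functions_iterated_partial) auto
  finally show ?thesis .
qed

lemma partial_derivative_add:
  "smooth f \<Longrightarrow> smooth g \<Longrightarrow>
    partial_derivative i (\<lambda>x. f x + g x) =
    (\<lambda>x. partial_derivative i f x + partial_derivative i g x)"
  by (rule ext, rule trans[OF partial_derivative_eq[OF has_derivative_add]])
    (auto simp: frechet_derivative_works[symmetric] smooth_differentiable partial_derivative_def)

lemma partial_derivative_mult:
  fixes f g :: "real ^ 'n \<Rightarrow> 'k::real_normed_algebra"
  shows "smooth f \<Longrightarrow> smooth g \<Longrightarrow>
    partial_derivative i (\<lambda>x. f x * g x) =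
    (\<lambda>x. f x * partial_derivative i g x + partial_derivative i f x * g x)"
  by (rule ext, rule trans[OF partial_derivative_eq[OF has_derivative_mult]])
    (auto simp: frechet_derivative_works[symmetric] smooth_differentiable partial_derivative_def)

lemma iterated_partial_add:
  assumes "smooth f" "smooth g"
  shows "iterated_partial is (\<lambda>x. f x + g x) =
    (\<lambda>x. iterated_partial is f x + iterated_partial is g x)"
  using assms
proof (induction "is" arbitrary: f g rule: rev_induct)
  case (snoc i "is")
  then show ?case
    by (simp add: iterated_partial_snoc partial_derivative_add smooth_partial_derivative)
qed simp

text \<open>The product rule turns one derivative into two products, one with \<open>\<phi>\<close>
  differentiated and one with \<open>\<rho>\<close> differentiated. The induction hypothesis bounds
  both, since its constant depends on \<open>\<rho>\<close> and the list but serves all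
  \<open>\<phi>\<close>.\<close>

lemma norm_iterated_partial_mult_le:
  fixes \<rho> :: "real ^ 'n \<Rightarrow> 'k::real_normed_field"
  assumes "\<rho> \<in> test_functions UNIV"
  shows "\<exists>B. \<forall>\<phi>\<in>test_functions UNIV. \<forall>x.
    norm (iterated_partial is (\<lambda>x. \<rho> x * \<phi> x) x) \<le> B * Ck_norm (length is) \<phi>"
  using assms
proof (induction "is" arbitrary: \<rho> rule: rev_induct)
  case Nil
  obtain B where B: "\<And>x. norm (\<rho> x) \<le> B"
    using test_functions_bounded[OF Nil] by (auto simp: bdd_above_def)
  have "norm (\<rho> x * \<phi> x) \<le> B * Ck_norm 0 \<phi>" if "\<phi> \<in> test_functions UNIV" for \<phi> :: "real ^ 'n \<Rightarrow> 'k" and x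
    unfolding norm_mult
    using norm_iterated_partial_le_Ck_norm[OF that, of "[]" 0 x] B[of x]
      order_trans[OF norm_ge_zero B]
    by (intro mult_mono) auto
  then show ?case by auto
next
  case (snoc i "is")
  obtain A B where
    A: "\<And>\<phi> x. \<phi> \<in> test_functions UNIV \<Longrightarrow>
      norm (iterated_partial is (\<lambda>x. \<rho> x * \<phi> x) x) \<le> A * Ck_norm (length is) \<phi>" and
    B: "\<And>\<phi> x. \<phi> \<in> test_functions UNIV \<Longrightarrow>
      norm (iterated_partial is (\<lambda>x. partial_derivative i \<rho> x * \<phi> x) x) \<le> B * Ck_norm (length is) \<phi>"
    using snoc.IH[OF snoc.prems] snoc.IH[OF test_functions_partial_derivative[OF snoc.prems]] by metis
  let ?m = "Suc (length is)"
  have "norm (iterated_partial (is @ [i]) (\<lambda>x. \<rho> x * \<phi> x) x) \<le> (\<bar>A\<bar> + \<bar>B\<bar>) * Ck_norm ?m \<phi>"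
    if \<phi>: "\<phi> \<in> test_functions UNIV" for \<phi> x
  proof -
    note d = test_functions_partial_derivative[OF \<phi>] test_functions_partial_derivative[OF snoc.prems]
    note s = snoc.prems \<phi> d
    have "iterated_partial (is @ [i]) (\<lambda>x. \<rho> x * \<phi> x) x =
        iterated_partial is (\<lambda>x. \<rho> x * partial_derivative i \<phi> x) x +
        iterated_partial is (\<lambda>x. partial_derivative i \<rho> x * \<phi> x) x"
      using s by (simp add: iterated_partial_snoc partial_derivative_mult iterated_partial_add
          test_functions_smooth smooth_mult smooth_partial_derivative)
    also have "norm \<dots> \<le> A * Ck_norm (length is) (partial_derivative i \<phi>) + B * Ck_norm (length is) \<phi>"
      by (intro norm_triangle_mono A B d \<phi>)
    also have "\<dots> \<le> \<bar>A\<bar> * Ck_norm ?m \<phi> + \<bar>B\<bar> * Ck_norm ?m \<phi>"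
      using \<phi> d by (intro add_mono mult_mono Ck_norm_partial_derivative Ck_norm_mono Ck_norm_nonneg) auto
    finally show ?thesis by (simp add: distrib_right)
  qed
  then show ?case by auto
qed

text \<open>Summing the bounds over the finitely many lists gives the constant. The estimate
  transfers the continuity of local distributions to the glued one.\<close>

lemma Ck_norm_mult_le:
  fixes \<rho> :: "real ^ 'n \<Rightarrow> 'k::real_normed_field"
  assumes "\<rho> \<in> test_functions UNIV"
  shows "\<exists>B\<ge>0. \<forall>\<phi>\<in>test_functions UNIV. Ck_norm k (\<lambda>x. \<rho> x * \<phi> x) \<le> B * Ck_norm k \<phi>"
proof -
  obtain B where B: "\<And>is \<phi> x. \<phi> \<in> test_functions UNIV \<Longrightarrow>
      norm (iterated_partial is (\<lambda>x. \<rho> x * \<phi> x) x) \<le> B is * Ck_norm (length is) \<phi>"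
    using norm_iterated_partial_mult_le[OF assms] by metis
  have "Ck_norm k (\<lambda>x. \<rho> x * \<phi> x) \<le> (\<Sum>is | length is \<le> k. \<bar>B is\<bar>) * Ck_norm k \<phi>"
    if \<phi>: "\<phi> \<in> test_functions UNIV" for \<phi>
    unfolding Ck_norm_def[of k "\<lambda>x. \<rho> x * \<phi> x"] sum_distrib_right
  proof (intro sum_mono cSUP_least)
    fix "is" :: "'n list" and x assume "is \<in> {is. length is \<le> k}"
    then have "B is * Ck_norm (length is) \<phi> \<le> \<bar>B is\<bar> * Ck_norm k \<phi>"
      using \<phi> by (intro mult_mono Ck_norm_mono Ck_norm_nonneg) auto
    with B[OF \<phi>, of "is" x] show "norm (iterated_partial is (\<lambda>x. \<rho> x * \<phi> x) x) \<le> \<bar>B is\<bar> * Ck_norm k \<phi>"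
      by linarith
  qed auto
  then show ?thesis by (intro exI[of _ "\<Sum>is | length is \<le> k. \<bar>B is\<bar>"]) (auto intro: sum_nonneg)
qed

section \<open>Bump functions and smooth partitions of unity\<close>

lemma plateau_test_function:
  fixes W :: "(real ^ 'n) set"
  assumes "open W" "a \<in> W"
  obtains r and \<eta> :: "real ^ 'n \<Rightarrow> real" where "r > 0"
    "(\<lambda>x. of_real (\<eta> x) :: 'k::real_normed_field) \<in> test_functions W"
    "\<And>x. 0 \<le> \<eta> x" "\<And>x. x \<in> ball a r \<Longrightarrow> \<eta> x = 1"
proof -
  obtain e where e: "e > 0" "cball a e \<subseteq> W"
    using assms open_contains_cball by blast
  define r where "r = e / 2"
  have r: "r > 0" "cball a (2 * r) \<subseteq> W" using e by (auto simp: r_def)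
  obtain \<eta> :: "real ^ 'n \<Rightarrow> real"
    where \<eta>: "\<And>m. smooth_upto m \<eta>" "\<And>x. 0 \<le> \<eta> x" "\<And>x. dist a x \<le> r \<Longrightarrow> \<eta> x = 1"
      "\<And>x. dist a x \<ge> 2 * r \<Longrightarrow> \<eta> x = 0"
    using plateau_function[OF r(1)] by blast
  let ?\<phi> = "\<lambda>x. of_real (\<eta> x) :: 'k"
  have "smooth ?\<phi>" by (simp add: smooth_iff_smooth_upto smooth_upto_of_real \<eta>)
  moreover have "supp ?\<phi> \<subseteq> cball a (2 * r)"
    unfolding supp_def by (rule closure_minimal) (use \<eta>(4) in force)+
  ultimately have "?\<phi> \<in> test_functions W"
    using r compact_supp_subset[OF compact_cball] by (auto simp: test_functions_def)
  with r \<eta> that show thesis by auto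
qed

text \<open>The family is indexed by numbers, so that one member may occur repeatedly and a new
  summand can simply be appended. The functions take values in the scalar field of the test
  functions that they multiply.\<close>

definition smooth_partition ::
    "(real ^ 'n) set set \<Rightarrow> (real ^ 'n) set \<Rightarrow> nat \<Rightarrow> (nat \<Rightarrow> (real ^ 'n) set) \<Rightarrow>
      (nat \<Rightarrow> real ^ 'n \<Rightarrow> 'k::real_normed_field) \<Rightarrow> bool"
  where "smooth_partition \<U> K n V \<rho> \<longleftrightarrow>
    (\<forall>i<n. V i \<in> \<U> \<and> \<rho> i \<in> test_functions (V i)) \<and> (\<forall>x\<in>K. (\<Sum>i<n. \<rho> i x) = 1)"

text \<open>Compactness leaves finitely many balls, each with a bump function equal to
  \<open>1\<close> on it; the bumps are then corrected one after another so that they sum to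
  \<open>1\<close>.\<close>

lemma smooth_partition_exists:
  fixes \<U> :: "(real ^ 'n) set set"
  assumes "compact K" "K \<subseteq> \<Union>\<U>" "\<And>U. U \<in> \<U> \<Longrightarrow> open U"
  shows "\<exists>n V (\<rho> :: nat \<Rightarrow> real ^ 'n \<Rightarrow> 'k::real_normed_field). smooth_partition \<U> K n V \<rho>"
proof -
  have "\<exists>r (\<phi> :: real ^ 'n \<Rightarrow> 'k). \<exists>U\<in>\<U>. r > 0 \<and> \<phi> \<in> test_functions U \<and> (\<forall>x\<in>ball a r. \<phi> x = 1)"
    if a: "a \<in> K" for a
  proof -
    obtain U where "U \<in> \<U>" "a \<in> U" using a assms(2) by blast
    with plateau_test_function[of U a] assms(3) show ?thesis
      by (metis of_real_1)
  qed
  then obtain r \<phi> U where *: "\<And>a. a \<in> K \<Longrightarrow> U a \<in> \<U> \<and> r a > 0 \<and>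
      (\<phi> a :: real ^ 'n \<Rightarrow> 'k) \<in> test_functions (U a) \<and> (\<forall>x\<in>ball a (r a). \<phi> a x = 1)"
    by metis
  have cover: "K \<subseteq> (\<Union>a\<in>K. ball a (r a))"
    using * by (meson UN_I centre_in_ball subsetI)
  obtain A where A: "A \<subseteq> K" "finite A" "K \<subseteq> (\<Union>a\<in>A. ball a (r a))"
    by (rule compactE_image[OF assms(1) open_ball cover])
  \<comment> \<open>Induction on the set of centres calls for a set that grows with it, so the sum
    is made \<open>1\<close> on the union of the balls instead of on \<open>K\<close>.\<close>
  have "\<exists>n V (\<rho> :: nat \<Rightarrow> real ^ 'n \<Rightarrow> 'k). smooth_partition \<U> (\<Union>a\<in>A. ball a (r a)) n V \<rho>"
    using A(2,1)
  proof (induction A)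
    case empty
    show ?case by (rule exI[of _ 0]) (simp add: smooth_partition_def)
  next
    case (insert a A)
    then obtain n V and \<rho> :: "nat \<Rightarrow> real ^ 'n \<Rightarrow> 'k"
      where p: "smooth_partition \<U> (\<Union>a\<in>A. ball a (r a)) n V \<rho>" by blast
    define s where "s x = (\<Sum>i<n. \<rho> i x)" for x
    \<comment> \<open>The missing amount \<open>1 - s\<close> is added where \<open>\<phi> a\<close>
      equals \<open>1\<close>; where \<open>s\<close> is already \<open>1\<close> nothing
      changes.\<close>
    define \<sigma> where "\<sigma> x = (1 - s x) * \<phi> a x" for x
    have "smooth s" unfolding s_def
      using p by (intro smooth_sum) (auto simp: smooth_partition_def test_functions_smooth)
    then have "\<sigma> \<in> test_functions (U a)"
      using * insert.prems unfolding \<sigma>_def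
      by (intro test_functions_smooth_mult smooth_diff smooth_const) auto
    moreover have "s x + \<sigma> x = 1" if "x \<in> (\<Union>a\<in>insert a A. ball a (r a))" for x
    proof (cases "x \<in> ball a (r a)")
      case True
      then have "\<phi> a x = 1" using * insert.prems by blast
      then show ?thesis by (simp add: \<sigma>_def)
    next
      case False
      then have "s x = 1" using p that by (auto simp: smooth_partition_def s_def)
      then show ?thesis by (simp add: \<sigma>_def)
    qed
    ultimately have "smooth_partition \<U> (\<Union>a\<in>insert a A. ball a (r a)) (Suc n) (V(n := U a)) (\<rho>(n := \<sigma>))"
      using p * insert.prems unfolding smooth_partition_def by (auto simp: less_Suc_eq s_def)
    then show ?case by blast
  qed
  with A(3) show ?thesis unfolding smooth_partition_def by blast
qed

section \<open>Distributions and their gluing\<close>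

lemma distribution_add:
  "T \<in> distributions U \<Longrightarrow> \<phi> \<in> test_functions U \<Longrightarrow> \<psi> \<in> test_functions U \<Longrightarrow>
    T (\<lambda>x. \<phi> x + \<psi> x) = T \<phi> + T \<psi>"
  by (simp add: distributions_def)

lemma distribution_scale:
  "T \<in> distributions U \<Longrightarrow> \<phi> \<in> test_functions U \<Longrightarrow> T (\<lambda>x. c * \<phi> x) = c * T \<phi>"
  by (simp add: distributions_def)

text \<open>Since \<open>Ck_norm\<close> is nonnegative, \<open>B\<close> can be replaced by its
  absolute value; a nonnegative constant can be multiplied into inequalities.\<close>

lemma distribution_bound:
  assumes "T \<in> distributions U" "compact K" "K \<subseteq> U"
  obtains B k where "B \<ge> 0"
    "\<And>\<phi>. \<phi> \<in> test_functions U \<Longrightarrow> supp \<phi> \<subseteq> K \<Longrightarrow> norm (T \<phi>) \<le> B * Ck_norm k \<phi>"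
proof -
  have "\<exists>B k. \<forall>\<phi>\<in>test_functions U. supp \<phi> \<subseteq> K \<longrightarrow> norm (T \<phi>) \<le> B * Ck_norm k \<phi>"
    using assms by (simp add: distributions_def)
  then obtain B k
    where B: "\<And>\<phi>. \<phi> \<in> test_functions U \<Longrightarrow> supp \<phi> \<subseteq> K \<Longrightarrow> norm (T \<phi>) \<le> B * Ck_norm k \<phi>"
    by metis
  have "norm (T \<phi>) \<le> \<bar>B\<bar> * Ck_norm k \<phi>" if "\<phi> \<in> test_functions U" "supp \<phi> \<subseteq> K" for \<phi>
    using B[OF that] mult_right_mono[OF abs_ge_self[of B] Ck_norm_nonneg[OF that(1)]]
    by (rule order_trans)
  then show thesis using that[of "\<bar>B\<bar>" k] by auto
qed

lemma distribution_zero: "T \<in> distributions U \<Longrightarrow> T (\<lambda>x. 0) = 0"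
  using distribution_scale[OF _ test_functions_zero, of T U 0] by simp

lemma distribution_sum:
  assumes "T \<in> distributions U" "\<And>i. i \<in> I \<Longrightarrow> \<phi> i \<in> test_functions U"
  shows "T (\<lambda>x. \<Sum>i\<in>I. \<phi> i x) = (\<Sum>i\<in>I. T (\<phi> i))"
  using assms(2)
proof (induction I rule: infinite_finite_induct)
  case (insert i I)
  then show ?case
    by (simp add: distribution_add[OF assms(1)] test_functions_sum)
qed (use assms(1) in \<open>auto simp: distribution_zero\<close>)

text \<open>The glued functional sends \<open>\<phi>\<close> to the sum of the values of
  \<open>T (V i)\<close> at \<open>\<rho> i\<close> times \<open>\<phi>\<close> over a partition of
  unity on the support of \<open>\<phi>\<close>. The value does not depend on the partition, so
  linearity and continuity can each be checked with a partition suited to them.\<close>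

lemma glue_distributions:
  fixes T :: "(real ^ 'n) set \<Rightarrow> (real ^ 'n \<Rightarrow> 'k::{real_normed_field,euclidean_space}) \<Rightarrow> 'k"
  assumes op: "\<And>U. U \<in> \<U> \<Longrightarrow> open U"
    and T: "\<And>U. U \<in> \<U> \<Longrightarrow> T U \<in> distributions U"
    and agree: "\<And>U V \<phi>. U \<in> \<U> \<Longrightarrow> V \<in> \<U> \<Longrightarrow> \<phi> \<in> test_functions (U \<inter> V) \<Longrightarrow> T U \<phi> = T V \<phi>"
  shows "\<exists>G\<in>distributions (\<Union>\<U>). \<forall>U\<in>\<U>. \<forall>\<phi>\<in>test_functions U. T U \<phi> = G \<phi>"
proof -
  define S where "S n V \<rho> \<phi> = (\<Sum>i<n. T (V i) (\<lambda>x. \<rho> i x * \<phi> x))"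
    for n :: nat and V \<rho> and \<phi> :: "real ^ 'n \<Rightarrow> 'k"
  have local_sum: "\<phi> = (\<lambda>x. \<Sum>i<n. \<rho> i x * \<phi> x)"
    if "smooth_partition \<U> (supp \<phi>) n V \<rho>" for n V \<rho> and \<phi> :: "real ^ 'n \<Rightarrow> 'k"
  proof
    show "\<phi> x = (\<Sum>i<n. \<rho> i x * \<phi> x)" for x
      using that not_in_supp[of x \<phi>]
      by (cases "x \<in> supp \<phi>") (auto simp: smooth_partition_def sum_distrib_right[symmetric])
  qed
  \<comment> \<open>Every summand is supported in an overlap with \<open>U\<close>, so agreement
    moves all of them to \<open>T U\<close>, where linearity reassembles
    \<open>\<phi>\<close>.\<close>
  have S_local: "S n V \<rho> \<phi> = T U \<phi>"
    if p: "smooth_partition \<U> (supp \<phi>) n V \<rho>" and U: "U \<in> \<U>" and \<phi>: "\<phi> \<in> test_functions U"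
    for n V \<rho> U \<phi>
  proof -
    have \<rho>\<phi>: "(\<lambda>x. \<rho> i x * \<phi> x) \<in> test_functions (V i \<inter> U)" "V i \<in> \<U>" if "i < n" for i
      using p \<phi> that by (auto simp: smooth_partition_def intro: test_functions_mult)
    have "S n V \<rho> \<phi> = (\<Sum>i<n. T U (\<lambda>x. \<rho> i x * \<phi> x))"
      unfolding S_def using \<rho>\<phi> agree U by (intro sum.cong) auto
    also have "\<dots> = T U (\<lambda>x. \<Sum>i<n. \<rho> i x * \<phi> x)"
      using \<rho>\<phi> by (intro distribution_sum[symmetric, OF T[OF U]]) (meson inf_le2 lessThan_iff test_functions_mono subsetD)
    finally show ?thesis using local_sum[OF p] by simp
  qed
  \<comment> \<open>Two partitions are compared through their products: each \<open>\<rho> i\<close>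
    times \<open>\<phi>\<close> lives on one member and is expanded by \<open>\<sigma>\<close>;
    after swapping the sums, summing over \<open>i\<close> removes \<open>\<rho>\<close>.\<close>
  have S_unique: "S n V \<rho> \<phi> = S m W \<sigma> \<phi>"
    if p: "smooth_partition \<U> (supp \<phi>) n V \<rho>" and q: "smooth_partition \<U> (supp \<phi>) m W \<sigma>"
      and \<phi>: "\<phi> \<in> test_functions UNIV" for n V \<rho> m W \<sigma> \<phi>
  proof -
    have \<rho>: "V i \<in> \<U>" "\<rho> i \<in> test_functions (V i)" if "i < n" for i
      using p that by (auto simp: smooth_partition_def)
    have \<sigma>: "W j \<in> \<U>" "\<sigma> j \<in> test_functions (W j)" if "j < m" for j
      using q that by (auto simp: smooth_partition_def)
    have \<rho>\<phi>: "(\<lambda>x. \<rho> i x * \<phi> x) \<in> test_functions (V i)" if "i < n" for i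
      using test_functions_mult[OF \<rho>(2)[OF that] \<phi>] by simp
    have "smooth_partition \<U> (supp (\<lambda>x. \<rho> i x * \<phi> x)) m W \<sigma>" if "i < n" for i
      using q supp_mono[of "\<lambda>x. \<rho> i x * \<phi> x" \<phi>] by (auto simp: smooth_partition_def)
    then have "S n V \<rho> \<phi> = (\<Sum>i<n. S m W \<sigma> (\<lambda>x. \<rho> i x * \<phi> x))"
      unfolding S_def[of n V] using \<rho> \<rho>\<phi> by (intro sum.cong refl S_local[symmetric]) auto
    also have "\<dots> = (\<Sum>j<m. \<Sum>i<n. T (W j) (\<lambda>x. \<sigma> j x * (\<rho> i x * \<phi> x)))"
      unfolding S_def by (rule sum.swap)
    also have "\<dots> = (\<Sum>j<m. T (W j) (\<lambda>x. \<Sum>i<n. \<sigma> j x * (\<rho> i x * \<phi> x)))"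
    proof (intro sum.cong refl distribution_sum[symmetric])
      fix i j assume "i \<in> {..<n}" "j \<in> {..<m}"
      then have "(\<lambda>x. \<sigma> j x * (\<rho> i x * \<phi> x)) \<in> test_functions (W j \<inter> V i)"
        using \<sigma> \<rho>\<phi> by (intro test_functions_mult) auto
      then show "(\<lambda>x. \<sigma> j x * (\<rho> i x * \<phi> x)) \<in> test_functions (W j)"
        using test_functions_mono[of "W j \<inter> V i" "W j"] by auto
    qed (use T \<sigma> in auto)
    also have "\<dots> = (\<Sum>j<m. T (W j) (\<lambda>x. \<sigma> j x * \<phi> x))"
      using local_sum[OF p] by (simp add: sum_distrib_left[symmetric] fun_eq_iff)
    finally show ?thesis by (simp add: S_def)
  qed
  have "\<exists>n V \<rho>. smooth_partition \<U> (supp \<phi>) n V \<rho>" if "\<phi> \<in> test_functions (\<Union>\<U>)"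
    for \<phi> :: "real ^ 'n \<Rightarrow> 'k"
    using that op smooth_partition_exists[of "supp \<phi>" \<U>] by (auto simp: test_functions_def)
  then obtain n V \<rho> where part: "\<And>\<phi> :: real ^ 'n \<Rightarrow> 'k. \<phi> \<in> test_functions (\<Union>\<U>) \<Longrightarrow>
      smooth_partition \<U> (supp \<phi>) (n \<phi>) (V \<phi>) (\<rho> \<phi> :: nat \<Rightarrow> real ^ 'n \<Rightarrow> 'k)"
    by metis
  define G where "G \<phi> = S (n \<phi>) (V \<phi>) (\<rho> \<phi>) \<phi>" for \<phi>
  \<comment> \<open>A partition over any set \<open>K\<close> containing the support computes
    \<open>G\<close>, so one partition serves several functions at once.\<close>
  have G_eq: "G \<phi> = S m W \<sigma> \<phi>"
    if "smooth_partition \<U> K m W \<sigma>" "supp \<phi> \<subseteq> K" "\<phi> \<in> test_functions (\<Union>\<U>)" for K m W \<sigma> \<phi>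
  proof -
    have "smooth_partition \<U> (supp \<phi>) m W \<sigma>" using that(1,2) by (auto simp: smooth_partition_def)
    then show ?thesis
      unfolding G_def using that by (intro S_unique part) (auto simp: test_functions_def)
  qed
  have terms: "T (W i) \<in> distributions (W i)" "(\<lambda>x. \<sigma> i x * \<phi> x) \<in> test_functions (W i)"
    if "smooth_partition \<U> K m W \<sigma>" "i < m" "\<phi> \<in> test_functions (\<Union>\<U>)" for K m W \<sigma> i \<phi>
    using that T test_functions_mult[of "\<sigma> i" "W i" \<phi> UNIV]
    by (auto simp: smooth_partition_def test_functions_iff[of \<phi> "\<Union>\<U>"])
  have "G (\<lambda>x. \<phi> x + \<psi> x) = G \<phi> + G \<psi>"
    if \<phi>\<psi>: "\<phi> \<in> test_functions (\<Union>\<U>)" "\<psi> \<in> test_functions (\<Union>\<U>)" for \<phi> \<psi>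
  proof -
    obtain m W \<sigma> where p: "smooth_partition \<U> (supp \<phi> \<union> supp \<psi>) m W (\<sigma> :: nat \<Rightarrow> real ^ 'n \<Rightarrow> 'k)"
      using smooth_partition_exists[of "supp \<phi> \<union> supp \<psi>" \<U>] \<phi>\<psi> op
      by (auto simp: test_functions_def intro: compact_Un)
    have "S m W \<sigma> (\<lambda>x. \<phi> x + \<psi> x) = S m W \<sigma> \<phi> + S m W \<sigma> \<psi>"
      unfolding S_def sum.distrib[symmetric]
      using distribution_add[OF terms(1)[OF p] terms(2)[OF p] terms(2)[OF p]] \<phi>\<psi>
      by (intro sum.cong) (auto simp: distrib_left)
    then show ?thesis
      using G_eq[OF p] \<phi>\<psi> supp_add[of \<phi> \<psi>] test_functions_add[OF \<phi>\<psi>] by simp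
  qed
  moreover have "G (\<lambda>x. c * \<phi> x) = c * G \<phi>" if \<phi>: "\<phi> \<in> test_functions (\<Union>\<U>)" for c \<phi>
  proof -
    have "S (n \<phi>) (V \<phi>) (\<rho> \<phi>) (\<lambda>x. c * \<phi> x) = c * S (n \<phi>) (V \<phi>) (\<rho> \<phi>) \<phi>"
      unfolding S_def sum_distrib_left
      using distribution_scale[OF terms(1)[OF part[OF \<phi>]] terms(2)[OF part[OF \<phi>] _ \<phi>], of _ _ c] \<phi>
      by (intro sum.cong) (auto simp: algebra_simps)
    moreover have "G (\<lambda>x. c * \<phi> x) = S (n \<phi>) (V \<phi>) (\<rho> \<phi>) (\<lambda>x. c * \<phi> x)"
    proof (rule G_eq[OF part[OF \<phi>]])
      show "supp (\<lambda>x. c * \<phi> x) \<subseteq> supp \<phi>" by (rule supp_mono) auto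
      show "(\<lambda>x. c * \<phi> x) \<in> test_functions (\<Union>\<U>)"
        by (rule test_functions_smooth_mult[OF smooth_const \<phi>])
    qed
    ultimately show ?thesis by (simp add: G_def)
  qed
  moreover have "\<exists>B k. \<forall>\<phi>\<in>test_functions (\<Union>\<U>). supp \<phi> \<subseteq> K \<longrightarrow> norm (G \<phi>) \<le> B * Ck_norm k \<phi>"
    if K: "compact K" "K \<subseteq> \<Union>\<U>" for K
  proof -
    obtain m W \<sigma> where p: "smooth_partition \<U> K m W (\<sigma> :: nat \<Rightarrow> real ^ 'n \<Rightarrow> 'k)"
      using smooth_partition_exists[OF K op] by blast
    have "\<exists>B k. B \<ge> 0 \<and> (\<forall>\<phi>\<in>test_functions (\<Union>\<U>). norm (T (W i) (\<lambda>x. \<sigma> i x * \<phi> x)) \<le> B * Ck_norm k \<phi>)"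
      if i: "i < m" for i
    proof -
      have \<sigma>: "W i \<in> \<U>" "\<sigma> i \<in> test_functions (W i)" using p i by (auto simp: smooth_partition_def)
      then have \<sigma>': "\<sigma> i \<in> test_functions UNIV" "compact (supp (\<sigma> i))" "supp (\<sigma> i) \<subseteq> W i"
        by (auto simp: test_functions_def)
      \<comment> \<open>The support of \<open>\<sigma> i\<close> is the compact set for the estimate
        of \<open>T (W i)\<close>; it contains the support of every product of
        \<open>\<sigma> i\<close> with a test function.\<close>
      obtain B k where B: "B \<ge> 0" "\<And>\<phi>. \<phi> \<in> test_functions (W i) \<Longrightarrow> supp \<phi> \<subseteq> supp (\<sigma> i) \<Longrightarrow>
          norm (T (W i) \<phi>) \<le> B * Ck_norm k \<phi>"
        using distribution_bound[OF T[OF \<sigma>(1)] \<sigma>'(2,3)] by blast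
      obtain A where A: "A \<ge> 0" "\<And>\<phi>. \<phi> \<in> test_functions UNIV \<Longrightarrow>
          Ck_norm k (\<lambda>x. \<sigma> i x * \<phi> x) \<le> A * Ck_norm k \<phi>"
        using Ck_norm_mult_le[OF \<sigma>'(1)] by blast
      have "norm (T (W i) (\<lambda>x. \<sigma> i x * \<phi> x)) \<le> B * A * Ck_norm k \<phi>"
        if \<phi>: "\<phi> \<in> test_functions (\<Union>\<U>)" for \<phi>
      proof -
        have "norm (T (W i) (\<lambda>x. \<sigma> i x * \<phi> x)) \<le> B * Ck_norm k (\<lambda>x. \<sigma> i x * \<phi> x)"
          by (rule B(2)[OF terms(2)[OF p i \<phi>]]) (rule supp_mono, auto)
        also have "\<dots> \<le> B * (A * Ck_norm k \<phi>)"
          using A(2) \<phi> B(1) by (intro mult_left_mono) (auto simp: test_functions_def)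
        finally show ?thesis by (simp add: mult.assoc)
      qed
      then show ?thesis using A(1) B(1) by (intro exI[of _ "B * A"] exI[of _ k]) auto
    qed
    then obtain B k where B: "\<And>i. i < m \<Longrightarrow> B i \<ge> 0" "\<And>i \<phi>. i < m \<Longrightarrow> \<phi> \<in> test_functions (\<Union>\<U>) \<Longrightarrow>
        norm (T (W i) (\<lambda>x. \<sigma> i x * \<phi> x)) \<le> B i * Ck_norm (k i) \<phi>"
      by metis
    \<comment> \<open>The sum of the orders dominates each of them.\<close>
    define l where "l = (\<Sum>i<m. k i)"
    have kl: "k i \<le> l" if "i < m" for i
      unfolding l_def using that by (intro member_le_sum) auto
    have "norm (G \<phi>) \<le> (\<Sum>i<m. B i) * Ck_norm l \<phi>"
      if \<phi>: "\<phi> \<in> test_functions (\<Union>\<U>)" "supp \<phi> \<subseteq> K" for \<phi>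
      unfolding G_eq[OF p \<phi>(2,1)] S_def sum_distrib_right
    proof (rule sum_norm_le)
      fix i assume "i \<in> {..<m}"
      then have "B i * Ck_norm (k i) \<phi> \<le> B i * Ck_norm l \<phi>"
        using kl B(1) by (intro mult_left_mono Ck_norm_mono[OF \<phi>(1)]) auto
      with B(2)[OF _ \<phi>(1), of i] \<open>i \<in> _\<close>
      show "norm (T (W i) (\<lambda>x. \<sigma> i x * \<phi> x)) \<le> B i * Ck_norm l \<phi>" by auto
    qed
    then show ?thesis by blast
  qed
  ultimately have "G \<in> distributions (\<Union>\<U>)"
    unfolding distributions_def by blast
  moreover have "T U \<phi> = G \<phi>" if "U \<in> \<U>" "\<phi> \<in> test_functions U" for U \<phi>
    using S_local[OF part that] that test_functions_mono[OF Union_upper[OF that(1)]] by (auto simp: G_def)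
  ultimately show ?thesis by blast
qed

section \<open>Additive increments on simply connected sets\<close>

text \<open>A cocycle condition inside members, analogous to closedness of a one-form; a function
  \<open>h\<close> with \<open>h y - h x = \<delta> x y\<close> is then a potential. Pairs in no
  common member are unconstrained.\<close>

definition additive_on :: "'a set set \<Rightarrow> ('a \<Rightarrow> 'a \<Rightarrow> 'k::ab_group_add) \<Rightarrow> bool"
  where "additive_on \<U> \<delta> \<longleftrightarrow>
    (\<forall>U\<in>\<U>. \<forall>x\<in>U. \<forall>y\<in>U. \<forall>z\<in>U. \<delta> x y + \<delta> y z = \<delta> x z)"

text \<open>The primitive lives on the parameter set \<open>Q\<close> and not on the image of
  \<open>H\<close>, so a path may return to a point with a different value.\<close>

definition local_primitive ::
    "'b::metric_space set \<Rightarrow> ('b \<Rightarrow> 'a) \<Rightarrow> ('a \<Rightarrow> 'a \<Rightarrow> 'k::ab_group_add) \<Rightarrow> ('b \<Rightarrow> 'k) \<Rightarrow> bool"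
  where "local_primitive Q H \<delta> k \<longleftrightarrow>
    (\<forall>s\<in>Q. \<exists>e>0. \<forall>t\<in>Q. dist s t < e \<longrightarrow> k t - k s = \<delta> (H s) (H t))"

lemma additive_on_refl: "additive_on \<U> \<delta> \<Longrightarrow> x \<in> \<Union>\<U> \<Longrightarrow> \<delta> x x = 0"
  unfolding additive_on_def by (metis UnionE add_cancel_left_right)

text \<open>The difference of two primitives is locally constant, hence constant on a connected
  set.\<close>

lemma local_primitive_diff_constant:
  assumes "local_primitive Q H \<delta> k" "local_primitive Q H \<delta> l" "connected Q" "a \<in> Q" "b \<in> Q"
  shows "k b - k a = l b - l a"
proof -
  have "k a - l a = k b - l b"
  proof (rule connected_local_const[where A = Q and f = "\<lambda>t. k t - l t"])
    show "\<forall>s\<in>Q. \<forall>\<^sub>F t in at s within Q. k s - l s = k t - l t"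
    proof
      fix s assume s: "s \<in> Q"
      obtain d e where "d > 0" "e > 0"
        "\<And>t. t \<in> Q \<Longrightarrow> dist s t < d \<Longrightarrow> k t - k s = \<delta> (H s) (H t)"
        "\<And>t. t \<in> Q \<Longrightarrow> dist s t < e \<Longrightarrow> l t - l s = \<delta> (H s) (H t)"
        using assms(1,2) s unfolding local_primitive_def by metis
      then have "\<forall>t\<in>Q. dist t s < min d e \<longrightarrow> k t - k s = l t - l s" "min d e > 0"
        by (auto simp: dist_commute)
      then show "\<forall>\<^sub>F t in at s within Q. k s - l s = k t - l t"
        unfolding eventually_at by (intro exI[of _ "min d e"]) (auto simp: algebra_simps)
    qed
  qed (use assms in auto)
  then show ?thesis by (simp add: algebra_simps)
qed

text \<open>Pulling back along \<open>g\<close> restricts a primitive on a square to curves in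
  it.\<close>

lemma local_primitive_compose:
  assumes "local_primitive Q H \<delta> k" "continuous_on P g" "g ` P \<subseteq> Q"
  shows "local_primitive P (\<lambda>t. H (g t)) \<delta> (\<lambda>t. k (g t))"
  unfolding local_primitive_def
proof
  fix s assume s: "s \<in> P"
  then obtain e where "e > 0" and e: "\<And>t. t \<in> Q \<Longrightarrow> dist (g s) t < e \<Longrightarrow> k t - k (g s) = \<delta> (H (g s)) (H t)"
    using assms unfolding local_primitive_def by blast
  obtain d where "d > 0" "\<And>t. t \<in> P \<Longrightarrow> dist t s < d \<Longrightarrow> dist (g t) (g s) < e"
    using assms(2) s \<open>e > 0\<close> unfolding continuous_on_iff by blast
  with e assms(3) show "\<exists>d>0. \<forall>t\<in>P. dist s t < d \<longrightarrow> k (g t) - k (g s) = \<delta> (H (g s)) (H (g t))"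
    by (metis dist_commute image_subset_iff)
qed

lemma local_primitive_cong:
  "local_primitive Q H \<delta> k \<Longrightarrow> (\<And>s. s \<in> Q \<Longrightarrow> H s = H' s) \<Longrightarrow> local_primitive Q H' \<delta> k"
  unfolding local_primitive_def by simp

text \<open>
  The primitive sums \<open>\<delta>\<close> along a subdivided segment from a base point; moving the endpoint
  changes the sum by a telescoping ladder.
\<close>

lemma local_primitive_exists:
  fixes Q :: "'b::real_normed_vector set" and H :: "'b \<Rightarrow> 'a::topological_space"
    and \<delta> :: "'a \<Rightarrow> 'a \<Rightarrow> 'k::ab_group_add"
  assumes add: "additive_on \<U> \<delta>" and op: "\<And>U. U \<in> \<U> \<Longrightarrow> open U"
    and Q: "compact Q" "convex Q" and H: "continuous_on Q H" "H ` Q \<subseteq> \<Union>\<U>"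
  shows "\<exists>k. local_primitive Q H \<delta> k"
proof (cases "Q = {}")
  case False
  then obtain p where p: "p \<in> Q" by blast
  have "\<forall>U\<in>\<U>. \<exists>W. open W \<and> W \<inter> Q = H -` U \<inter> Q"
    using H(1) op by (simp add: continuous_on_open_invariant)
  then obtain W where W: "\<And>U. U \<in> \<U> \<Longrightarrow> open (W U)" "\<And>U. U \<in> \<U> \<Longrightarrow> W U \<inter> Q = H -` U \<inter> Q"
    by metis
  have "Q \<subseteq> \<Union>(W ` \<U>)"
  proof
    fix x assume "x \<in> Q"
    moreover from this obtain U where "U \<in> \<U>" "H x \<in> U" using H(2) by auto
    ultimately show "x \<in> \<Union>(W ` \<U>)" using W(2)[of U] by auto
  qed
  \<comment> \<open>\<open>e\<close> is a Lebesgue number of the cover of \<open>Q\<close> by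
    preimages of members: \<open>H\<close> maps the points of \<open>Q\<close> within
    \<open>e\<close> of a given point of \<open>Q\<close> into a common member.\<close>
  then obtain e where e: "e > 0" "\<And>x. x \<in> Q \<Longrightarrow> \<exists>B\<in>W ` \<U>. ball x e \<subseteq> B"
    using Heine_Borel_lemma[OF Q(1), of "W ` \<U>"] W(1) by (metis imageE)
  have *: "\<delta> (H x) (H y) + \<delta> (H y) (H z) = \<delta> (H x) (H z)"
    if xyz: "x \<in> Q" "y \<in> Q" "z \<in> Q" and "dist x y < e" "dist x z < e" for x y z
  proof -
    obtain U where U: "U \<in> \<U>" "ball x e \<subseteq> W U" using e(2)[OF xyz(1)] by blast
    then have "{x, y, z} \<subseteq> W U \<inter> Q" using that e(1) by auto
    then have "H x \<in> U" "H y \<in> U" "H z \<in> U" using W(2)[OF U(1)] by auto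
    with add U(1) show ?thesis unfolding additive_on_def by blast
  qed
  have \<delta>_refl: "\<delta> (H x) (H x) = 0" if "x \<in> Q" for x
    using *[OF that that that] e(1) by simp
  obtain D where D: "D > 0" "\<And>x. x \<in> Q \<Longrightarrow> dist p x \<le> D"
    using compact_imp_bounded[OF Q(1)] by (metis bounded_any_center dist_commute less_le_trans zero_less_one max.cobounded1 max.coboundedI2 max.strict_coboundedI2)
  \<comment> \<open>\<open>n\<close> depends only on the bound \<open>D\<close> for the distance
    from \<open>p\<close>, so all segments from \<open>p\<close> into \<open>Q\<close> are divided
    into steps shorter than \<open>e / 2\<close> at once.\<close>
  obtain n :: nat where n: "n > 0" "D / n < e / 2"
  proof -
    obtain n :: nat where "2 * D / e < n" using reals_Archimedean2 by blast
    moreover from this have "n > 0" using D e by (metis divide_pos_pos gr0I less_numeral_extra(3) mult_pos_pos of_nat_0 order.asym zero_less_numeral)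
    ultimately show thesis using that e(1) D(1) by (auto simp: field_simps)
  qed
  define pt where "pt x i = p + (real i / real n) *\<^sub>R (x - p)" for x i
  have pt_Q: "pt x i \<in> Q" if "x \<in> Q" "i \<le> n" for x i
  proof -
    have "pt x i = (1 - real i / real n) *\<^sub>R p + (real i / real n) *\<^sub>R x"
      by (simp add: pt_def algebra_simps)
    moreover have "real i / real n \<le> 1" using that(2) n(1) by simp
    ultimately show ?thesis using convexD_alt[OF Q(2) p that(1), of "real i / real n"] by simp
  qed
  have pt_step: "dist (pt x i) (pt x (Suc i)) < e / 2" if "x \<in> Q" for x i
  proof -
    have "pt x (Suc i) - pt x i = (1 / real n) *\<^sub>R (x - p)"
      by (simp add: pt_def algebra_simps add_divide_distrib scaleR_left_distrib)
    then have "dist (pt x i) (pt x (Suc i)) = dist p x / n"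
      using n(1) by (metis (no_types) dist_commute dist_norm norm_scaleR abs_of_nonneg divide_nonneg_nonneg
          of_nat_0_le_iff zero_le_one mult.commute times_divide_eq_right mult_1_right)
    also have "\<dots> \<le> D / n" using D(2)[OF that] by (intro divide_right_mono) auto
    finally show ?thesis using n(2) by linarith
  qed
  have pt_move: "dist (pt x i) (pt y i) < e / 2" if "dist x y < e / 2" "i \<le> n" for x y i
  proof -
    have "pt x i - pt y i = (real i / real n) *\<^sub>R (x - y)"
      by (simp add: pt_def algebra_simps)
    then have "dist (pt x i) (pt y i) = (real i / real n) * dist x y"
      by (simp add: dist_norm)
    also have "\<dots> \<le> 1 * dist x y" using that n(1) by (intro mult_right_mono) auto
    finally show ?thesis using that by simp
  qed
  define k where "k x = (\<Sum>i<n. \<delta> (H (pt x i)) (H (pt x (Suc i))))" for x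
  have "k y - k x = \<delta> (H x) (H y)" if x: "x \<in> Q" and y: "y \<in> Q" and xy: "dist x y < e / 2" for x y
  proof -
    \<comment> \<open>\<open>g i\<close> is the rung between the two subdivided segments. Each cell
      yields its diagonal as a sum of two increments in two ways, so corresponding steps differ by
      \<open>g (Suc i) - g i\<close>.\<close>
    define g where "g i = \<delta> (H (pt x i)) (H (pt y i))" for i
    have "k y - k x = (\<Sum>i<n. \<delta> (H (pt y i)) (H (pt y (Suc i))) - \<delta> (H (pt x i)) (H (pt x (Suc i))))"
      by (simp add: k_def sum_subtractf)
    also have "\<dots> = (\<Sum>i<n. g (Suc i) - g i)"
    proof (rule sum.cong[OF refl])
      fix i assume "i \<in> {..<n}"
      then have i: "i \<le> n" "Suc i \<le> n" by auto
      note q = pt_Q[OF x i(1)] pt_Q[OF x i(2)] pt_Q[OF y i(1)] pt_Q[OF y i(2)]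
      have "dist (pt x i) (pt y (Suc i)) < e"
        using dist_triangle_less_add[of "pt x i" "pt y i" "e / 2" "pt y (Suc i)" "e / 2"]
          pt_move[OF xy i(1)] pt_step[OF y, of i] by (simp add: dist_commute)
      moreover have "dist (pt x i) (pt y i) < e" "dist (pt x i) (pt x (Suc i)) < e"
        using pt_move[OF xy i(1)] pt_step[OF x, of i] e(1) by auto
      ultimately have
        "g i + \<delta> (H (pt y i)) (H (pt y (Suc i))) = \<delta> (H (pt x i)) (H (pt y (Suc i)))"
        "\<delta> (H (pt x i)) (H (pt x (Suc i))) + g (Suc i) = \<delta> (H (pt x i)) (H (pt y (Suc i)))"
        using *[OF q(1,3,4)] *[OF q(1,2,4)] unfolding g_def by auto
      then have "g i + \<delta> (H (pt y i)) (H (pt y (Suc i))) = \<delta> (H (pt x i)) (H (pt x (Suc i))) + g (Suc i)"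
        by simp
      then show "\<delta> (H (pt y i)) (H (pt y (Suc i))) - \<delta> (H (pt x i)) (H (pt x (Suc i))) = g (Suc i) - g i"
        by (simp add: algebra_simps)
    qed
    also have "\<dots> = g n - g 0" by (rule sum_lessThan_telescope)
    \<comment> \<open>Both segments start at \<open>p\<close>, so the first rung vanishes; the last
      one joins \<open>x\<close> to \<open>y\<close>.\<close>
    also have "\<dots> = \<delta> (H x) (H y)"
      using n(1) \<delta>_refl[OF p] by (simp add: g_def pt_def)
    finally show ?thesis .
  qed
  then have "local_primitive Q H \<delta> k"
    unfolding local_primitive_def using e(1) by (meson half_gt_zero)
  then show ?thesis by blast
qed (simp add: local_primitive_def)

text \<open>Inside one member additivity makes \<open>\<delta> x\<close> a primitive outright; this
  evaluates the increment along a curve that stays in the member.\<close>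

lemma local_primitive_within_member:
  assumes "additive_on \<U> \<delta>" "U \<in> \<U>" "H ` Q \<subseteq> U" "x \<in> U"
  shows "local_primitive Q H \<delta> (\<lambda>t. \<delta> x (H t))"
proof -
  have "\<delta> x (H t) - \<delta> x (H s) = \<delta> (H s) (H t)" if "s \<in> Q" "t \<in> Q" for s t
    using assms that unfolding additive_on_def by (metis add_diff_cancel_left' image_subset_iff)
  then show ?thesis unfolding local_primitive_def by (meson zero_less_one)
qed

text \<open>The value \<open>h x\<close> is the total increment along a chosen path from
  \<open>a\<close> to \<open>x\<close>. For \<open>x\<close> and \<open>y\<close> in a member, the
  path to \<open>x\<close>, prolonged to \<open>y\<close> inside the member, is homotopic to the
  chosen path to \<open>y\<close>, and homotopic paths have the same increment.\<close>

lemma simply_connected_primitive: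
  fixes S :: "'a::real_normed_vector set" and \<delta> :: "'a \<Rightarrow> 'a \<Rightarrow> 'k::ab_group_add"
  assumes S: "simply_connected S" and cover: "\<Union>\<U> = S"
    and U: "\<And>U. U \<in> \<U> \<Longrightarrow> open U" "\<And>U. U \<in> \<U> \<Longrightarrow> path_connected U"
    and add: "additive_on \<U> \<delta>"
  shows "\<exists>h. \<forall>U\<in>\<U>. \<forall>x\<in>U. \<forall>y\<in>U. h y - h x = \<delta> x y"
proof (cases "S = {}")
  case False
  then obtain a where a: "a \<in> S" by blast
  let ?I = "{0..1::real}"
  have "\<exists>p. path p \<and> path_image p \<subseteq> S \<and> pathstart p = a \<and> pathfinish p = x" if "x \<in> S" for x
    using simply_connected_imp_path_connected[OF S] a that unfolding path_connected_def by blast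
  then obtain p where p: "\<And>x. x \<in> S \<Longrightarrow>
      path (p x) \<and> path_image (p x) \<subseteq> S \<and> pathstart (p x) = a \<and> pathfinish (p x) = x"
    by metis
  have "\<exists>k. local_primitive ?I (p x) \<delta> k" if "x \<in> S" for x
    using p[OF that] cover
    by (intro local_primitive_exists[OF add U(1)]) (auto simp: path_def path_image_def)
  then obtain K where K: "\<And>x. x \<in> S \<Longrightarrow> local_primitive ?I (p x) \<delta> (K x)" by metis
  define h where "h x = K x 1 - K x 0" for x
  have "h y - h x = \<delta> x y" if V: "V \<in> \<U>" and x: "x \<in> V" and y: "y \<in> V" for V x y
  proof -
    have xS: "x \<in> S" and yS: "y \<in> S" using V x y cover by auto
    obtain r where r: "path r" "path_image r \<subseteq> V" "pathstart r = x" "pathfinish r = y"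
      using U(2)[OF V] x y unfolding path_connected_def by blast
    have "path_image r \<subseteq> S" using r(2) V cover by auto
    then have "homotopic_paths S (p x +++ r) (p y)"
      using S p[OF xS] p[OF yS] r
      by (auto simp: simply_connected_eq_homotopic_paths path_image_join)
    then obtain H where H: "continuous_on (?I \<times> ?I) H" "H \<in> ?I \<times> ?I \<rightarrow> S"
      "\<And>t. t \<in> ?I \<Longrightarrow> H (0, t) = (p x +++ r) t" "\<And>t. t \<in> ?I \<Longrightarrow> H (1, t) = p y t"
      and ends: "\<And>t. t \<in> ?I \<Longrightarrow> pathstart (H \<circ> Pair t) = pathstart (p x +++ r) \<and>
        pathfinish (H \<circ> Pair t) = pathfinish (p x +++ r)"
      unfolding homotopic_paths by blast
    then have H_ends: "H (t, 0) = a" "H (t, 1) = y" if "t \<in> ?I" for t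
    proof -
      have "pathstart (H \<circ> Pair t) = a \<and> pathfinish (H \<circ> Pair t) = y"
        using ends[OF that] p[OF xS] r by simp
      then show "H (t, 0) = a" "H (t, 1) = y" by (simp_all add: pathstart_def pathfinish_def)
    qed
    \<comment> \<open>The homotopy square is compact and convex, so it carries a primitive;
      comparing its values at the corners gives the invariance under homotopy.\<close>
    obtain k where k: "local_primitive (?I \<times> ?I) H \<delta> k"
      using local_primitive_exists[OF add U(1), of "?I \<times> ?I" H] H cover
      by (auto simp: compact_Times convex_Times)
    \<comment> \<open>Along a curve in the square, \<open>k\<close> changes as much as any primitive
      of the path that \<open>H\<close> traces there.\<close>
    have side: "k (g 1) - k (g 0) = l 1 - l 0"
      if "local_primitive ?I q \<delta> l" "continuous_on ?I g" "g ` ?I \<subseteq> ?I \<times> ?I" "\<And>t. t \<in> ?I \<Longrightarrow> H (g t) = q t"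
      for g q l
      using local_primitive_diff_constant[OF local_primitive_cong[OF local_primitive_compose[OF k that(2,3)] that(4)] that(1)]
      by auto
    have const: "local_primitive ?I (\<lambda>_. z) \<delta> (\<lambda>_. 0)" if "z \<in> S" for z
      using additive_on_refl[OF add] cover that by (auto simp: local_primitive_def intro: exI[of _ 1])
    \<comment> \<open>The first coordinate is the homotopy parameter: the edges with second
      coordinate \<open>0\<close> and \<open>1\<close> are constant at \<open>a\<close> and
      \<open>y\<close>. The edge with first coordinate \<open>1\<close> traces \<open>p y\<close>;
      the opposite one traces \<open>p x\<close> up to \<open>1 / 2\<close> and then
      \<open>r\<close>.\<close>
    have "k (1, 0) - k (0, 0) = 0"
      using side[OF const[OF a], of "\<lambda>t. (t, 0)"] H_ends
      by (auto simp: image_subset_iff continuous_on_Pair)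
    moreover have "k (1, 1) - k (0, 1) = 0"
      using side[OF const[OF yS], of "\<lambda>t. (t, 1)"] H_ends
      by (auto simp: image_subset_iff continuous_on_Pair)
    moreover have "k (1, 1) - k (1, 0) = h y"
      using side[OF K[OF yS], of "\<lambda>t. (1, t)"] H(4)
      by (auto simp: h_def image_subset_iff continuous_on_Pair)
    moreover have "k (0, 1 / 2) - k (0, 0) = h x"
      using side[OF K[OF xS], of "\<lambda>t. (0, t / 2)"] H(3)
      by (auto simp: h_def joinpaths_def image_subset_iff continuous_on_Pair continuous_on_divide)
    moreover have "k (0, 1) - k (0, 1 / 2) = \<delta> x y"
    proof -
      have "local_primitive ?I r \<delta> (\<lambda>t. \<delta> x (r t))"
        using r(2) by (intro local_primitive_within_member[OF add V _ x]) (simp add: path_image_def)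
      moreover have "H (0, (1 + t) / 2) = r t" if "t \<in> ?I" for t
      proof -
        \<comment> \<open>At \<open>t = 0\<close> the joined path still takes its value from
          \<open>p x\<close>, which ends where \<open>r\<close> starts.\<close>
        have "(p x +++ r) ((1 + t) / 2) = r t"
          using that p[OF xS] r(3) by (cases "t = 0") (auto simp: joinpaths_def pathstart_def pathfinish_def add_divide_distrib)
        then show ?thesis using H(3)[of "(1 + t) / 2"] that by auto
      qed
      ultimately have "k (0, (1 + 1) / 2) - k (0, (1 + 0) / 2) = \<delta> x (r 1) - \<delta> x (r 0)"
        by (intro side[of r _ "\<lambda>t. (0, (1 + t) / 2)"]) (auto intro!: continuous_intros)
      then show ?thesis
        using r(3,4) additive_on_refl[OF add, of x] xS cover by (simp add: pathstart_def pathfinish_def)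
    qed
    ultimately show ?thesis
      by (simp add: algebra_simps)
  qed
  then show ?thesis by blast
qed (use cover in auto)

section \<open>Constant distributions and the splitting of the cocycle\<close>

lemma test_functions_integrable:
  fixes \<phi> :: "real ^ 'n \<Rightarrow> 'k::{real_normed_field,euclidean_space}"
  assumes "\<phi> \<in> test_functions U"
  shows "integrable lborel \<phi>"
proof -
  have "integrable lborel (\<lambda>x. indicator (supp \<phi>) x *\<^sub>R \<phi> x)"
    using assms by (intro borel_integrable_compact) (auto simp: test_functions_def smooth_continuous_on)
  moreover have "(\<lambda>x. indicator (supp \<phi>) x *\<^sub>R \<phi> x) = \<phi>"
    using not_in_supp[of _ \<phi>] by (force simp: indicator_def)
  ultimately show ?thesis by simp
qed

text \<open>A test function on \<open>U\<close> vanishes outside \<open>U\<close>, so the integral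
  can be taken over the whole space. This makes constants on different members comparable through
  one integral.\<close>

lemma const_distribution_eq:
  fixes \<phi> :: "real ^ 'n \<Rightarrow> 'k::{real_normed_field,euclidean_space}"
  assumes "\<phi> \<in> test_functions U"
  shows "const_distribution U c \<phi> = c * (\<integral>x. \<phi> x \<partial>lborel)"
proof -
  have "\<phi> x = 0" if "x \<notin> U" for x
    using assms that not_in_supp[of x \<phi>] by (auto simp: test_functions_def)
  then have "(\<lambda>x. indicator U x *\<^sub>R (c * \<phi> x)) = (\<lambda>x. c * \<phi> x)"
    by (auto simp: indicator_def)
  then show ?thesis
    unfolding const_distribution_def set_lebesgue_integral_def
    by (metis integral_mult_right_zero)
qed

text \<open>The integrand is bounded by its supremum on \<open>K\<close> and vanishes outside, so
  constants satisfy a distribution estimate of order \<open>0\<close>.\<close>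

lemma norm_integral_le_Ck_norm:
  fixes \<phi> :: "real ^ 'n \<Rightarrow> 'k::{real_normed_field,euclidean_space}"
  assumes "\<phi> \<in> test_functions U" "compact K" "supp \<phi> \<subseteq> K"
  shows "norm (\<integral>x. \<phi> x \<partial>lborel) \<le> measure lborel K * Ck_norm 0 \<phi>"
proof -
  have "norm (\<integral>x. \<phi> x \<partial>lborel) \<le> (\<integral>x. indicator K x * Ck_norm 0 \<phi> \<partial>lborel)"
  proof (rule Bochner_Integration.integral_norm_bound_integral)
    show "integrable lborel (\<lambda>x. indicator K x * Ck_norm 0 \<phi>)"
      using borel_integrable_compact[OF assms(2), of "\<lambda>_. Ck_norm 0 \<phi>"] by simp
    show "norm (\<phi> x) \<le> indicator K x * Ck_norm 0 \<phi>" for x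
      using norm_iterated_partial_le_Ck_norm[OF assms(1), of "[]" 0 x] not_in_supp[of x \<phi>] assms(3)
      by (auto simp: indicator_def)
  qed (rule test_functions_integrable[OF assms(1)])
  also have "\<dots> = measure lborel K * Ck_norm 0 \<phi>" by simp
  finally show ?thesis .
qed

lemma distribution_diff_const:
  fixes T :: "(real ^ 'n \<Rightarrow> 'k::{real_normed_field,euclidean_space}) \<Rightarrow> 'k"
  assumes T: "T \<in> distributions U"
  shows "(\<lambda>\<phi>. T \<phi> - const_distribution U c \<phi>) \<in> distributions U"
proof -
  let ?T = "\<lambda>\<phi>. T \<phi> - const_distribution U c \<phi>"
  have "?T (\<lambda>x. \<phi> x + \<psi> x) = ?T \<phi> + ?T \<psi>"
    if "\<phi> \<in> test_functions U" "\<psi> \<in> test_functions U" for \<phi> \<psi>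
    using that
    by (simp add: const_distribution_eq test_functions_add distribution_add[OF T]
        test_functions_integrable[where U = U] distrib_left)
  moreover have "?T (\<lambda>x. a * \<phi> x) = a * ?T \<phi>" if "\<phi> \<in> test_functions U" for a \<phi>
    using that
    by (simp add: const_distribution_eq test_functions_smooth_mult smooth_const
        distribution_scale[OF T] algebra_simps)
  moreover have "\<exists>B k. \<forall>\<phi>\<in>test_functions U. supp \<phi> \<subseteq> K \<longrightarrow> norm (?T \<phi>) \<le> B * Ck_norm k \<phi>"
    if K: "compact K" "K \<subseteq> U" for K
  proof -
    obtain B k where B: "B \<ge> 0" "\<And>\<phi>. \<phi> \<in> test_functions U \<Longrightarrow> supp \<phi> \<subseteq> K \<Longrightarrow> norm (T \<phi>) \<le> B * Ck_norm k \<phi>"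
      using distribution_bound[OF T K] by metis
    have "norm (?T \<phi>) \<le> (B + norm c * measure lborel K) * Ck_norm k \<phi>"
      if \<phi>: "\<phi> \<in> test_functions U" "supp \<phi> \<subseteq> K" for \<phi>
    proof -
      have "norm (?T \<phi>) \<le> norm (T \<phi>) + norm c * norm (\<integral>x. \<phi> x \<partial>lborel)"
        using norm_triangle_ineq4 by (metis const_distribution_eq[OF \<phi>(1)] norm_mult)
      also have "\<dots> \<le> B * Ck_norm k \<phi> + norm c * (measure lborel K * Ck_norm k \<phi>)"
        using norm_integral_le_Ck_norm[OF \<phi>(1) K(1) \<phi>(2)] B(2)[OF \<phi>]
          mult_left_mono[OF Ck_norm_mono[OF \<phi>(1), of 0 k], of "measure lborel K"]
        by (intro add_mono mult_left_mono) auto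
      finally show ?thesis by (simp add: algebra_simps)
    qed
    then show ?thesis by blast
  qed
  ultimately show ?thesis unfolding distributions_def by blast
qed

text \<open>A nonnegative bump function equal to \<open>1\<close> on a ball has integral at least
  the volume of the ball. Such a function detects the constant of a constant distribution.\<close>

lemma test_function_nonzero_integral:
  fixes W :: "(real ^ 'n) set"
  assumes "open W" "W \<noteq> {}"
  shows "\<exists>\<phi>\<in>test_functions W.
    (\<integral>x. \<phi> x \<partial>lborel) \<noteq> (0 :: 'k::{real_normed_field,euclidean_space})"
proof -
  obtain a where "a \<in> W" using assms(2) by blast
  then obtain r and \<eta> :: "real ^ 'n \<Rightarrow> real" where r: "r > 0"
    and \<eta>: "(\<lambda>x. of_real (\<eta> x) :: 'k) \<in> test_functions W" "\<And>x. 0 \<le> \<eta> x"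
      "\<And>x. x \<in> ball a r \<Longrightarrow> \<eta> x = 1"
    using plateau_test_function[OF assms(1), of a] by metis
  \<comment> \<open>The real function inherits integrability because
    \<open>norm (of_real (\<eta> x)) = \<eta> x\<close> for nonnegative values.\<close>
  have int: "integrable lborel \<eta>"
    using integrable_norm[OF test_functions_integrable[OF \<eta>(1)]] \<eta>(2) by simp
  have "integrable lborel (indicator (ball a r) :: real ^ 'n \<Rightarrow> real)"
    by (intro integrable_real_indicator emeasure_lborel_ball_finite) auto
  then have "measure lborel (ball a r) \<le> (\<integral>x. \<eta> x \<partial>lborel)"
    using integral_mono[of lborel "indicator (ball a r)" \<eta>] int \<eta> by (simp add: indicator_def)
  with content_ball_pos[OF r, of a] have "(\<integral>x. \<eta> x \<partial>lborel) \<noteq> 0" by linarith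
  then have "(\<integral>x. of_real (\<eta> x) \<partial>lborel) \<noteq> (0 :: 'k)"
    using integral_of_real[OF int, where 'a = 'k] by simp
  with \<eta>(1) show ?thesis by blast
qed

section \<open>Splitting the cocycle of constants on overlaps\<close>

theorem corollary1p3:
  fixes \<Omega> :: "(real ^ 'n) set"
    and \<U> :: "(real ^ 'n) set set"
    and F :: "(real ^ 'n) set \<Rightarrow> (real ^ 'n \<Rightarrow> 'k::{real_normed_field,euclidean_space}) \<Rightarrow> 'k"
  assumes "open \<Omega>" and "simply_connected \<Omega>"
    and "\<Union>\<U> = \<Omega>"
    and "\<And>U. U \<in> \<U> \<Longrightarrow> open U \<and> path_connected U"
    and "\<And>U. U \<in> \<U> \<Longrightarrow> F U \<in> distributions U"
    and "\<And>U V. U \<in> \<U> \<Longrightarrow> V \<in> \<U> \<Longrightarrow> U \<inter> V \<noteq> {} \<Longrightarrow>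
      \<exists>c. \<forall>\<phi>\<in>test_functions (U \<inter> V).
        F V \<phi> - F U \<phi> = const_distribution (U \<inter> V) c \<phi>"
  shows "\<exists>(C :: (real ^ 'n) set \<Rightarrow> 'k). \<exists>G\<in>distributions \<Omega>.
    \<forall>U\<in>\<U>. \<forall>\<phi>\<in>test_functions U. F U \<phi> = G \<phi> + const_distribution U (C U) \<phi>"
proof -
  have "\<exists>c. \<forall>\<phi>\<in>test_functions (U \<inter> V). F V \<phi> - F U \<phi> = c * (\<integral>x. \<phi> x \<partial>lborel)"
    if "U \<in> \<U>" "V \<in> \<U>" "U \<inter> V \<noteq> {}" for U V
    using assms(6)[OF that] by (auto simp: const_distribution_eq)
  then obtain c where c: "\<And>U V \<phi>. U \<in> \<U> \<Longrightarrow> V \<in> \<U> \<Longrightarrow> U \<inter> V \<noteq> {} \<Longrightarrow>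
      \<phi> \<in> test_functions (U \<inter> V) \<Longrightarrow> F V \<phi> - F U \<phi> = c U V * (\<integral>x. \<phi> x \<partial>lborel)"
    by metis
  \<comment> \<open>On the triple overlap the differences of distributions add up, and a test
    function with nonzero integral compares the constants. The point \<open>x\<close> certifies that
    the overlap is nonempty.\<close>
  have cocycle: "c U V + c V W = c U W"
    if UVW: "U \<in> \<U>" "V \<in> \<U>" "W \<in> \<U>" and x: "x \<in> U" "x \<in> V" "x \<in> W" for U V W x
  proof -
    have "open (U \<inter> V \<inter> W)" "U \<inter> V \<inter> W \<noteq> {}" using assms(4) that by auto
    then obtain \<phi> :: "real ^ 'n \<Rightarrow> 'k" where \<phi>: "\<phi> \<in> test_functions (U \<inter> V \<inter> W)"
      and I: "(\<integral>x. \<phi> x \<partial>lborel) \<noteq> 0"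
      using test_function_nonzero_integral by metis
    have "\<phi> \<in> test_functions (U \<inter> V)" "\<phi> \<in> test_functions (V \<inter> W)" "\<phi> \<in> test_functions (U \<inter> W)"
      using \<phi> by (auto simp: test_functions_def)
    then have "F V \<phi> - F U \<phi> = c U V * (\<integral>x. \<phi> x \<partial>lborel)"
      "F W \<phi> - F V \<phi> = c V W * (\<integral>x. \<phi> x \<partial>lborel)"
      "F W \<phi> - F U \<phi> = c U W * (\<integral>x. \<phi> x \<partial>lborel)"
      using c UVW x by blast+
    then have "(c U V + c V W) * (\<integral>x. \<phi> x \<partial>lborel) = c U W * (\<integral>x. \<phi> x \<partial>lborel)"
      by (simp add: distrib_right) (metis add_diff_cancel_left' add_diff_eq diff_add_cancel)
    with I show ?thesis by simp
  qed
  have c_refl: "c U U = 0" if "U \<in> \<U>" "x \<in> U" for U x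
    using cocycle[of U U U x] that by simp
  have c_sym: "c U V = - c V U" if "U \<in> \<U>" "V \<in> \<U>" "x \<in> U" "x \<in> V" for U V x
    using cocycle[of U V U x] c_refl[of U x] that by (simp add: eq_neg_iff_add_eq_0)
  have "\<exists>A. \<forall>x\<in>\<Omega>. A x \<in> \<U> \<and> x \<in> A x"
    using assms(3) by (intro bchoice) blast
  then obtain A where A: "\<And>x. x \<in> \<Omega> \<Longrightarrow> A x \<in> \<U> \<and> x \<in> A x" by blast
  have A': "A x \<in> \<U>" "x \<in> A x" if "U \<in> \<U>" "x \<in> U" for U x
    using A[of x] assms(3) that by auto
  text \<open>Any member \<open>U\<close> containing both points gives the same value.\<close>
  define \<delta> where "\<delta> x y = (let U = SOME U. U \<in> \<U> \<and> x \<in> U \<and> y \<in> U in c (A x) U + c U (A y))" for x y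
  have \<delta>: "\<delta> x y = c (A x) U + c U (A y)" if U: "U \<in> \<U>" and xy: "x \<in> U" "y \<in> U" for U x y
  proof -
    define V where "V = (SOME U. U \<in> \<U> \<and> x \<in> U \<and> y \<in> U)"
    have V: "V \<in> \<U>" "x \<in> V" "y \<in> V"
      using someI[of "\<lambda>U. U \<in> \<U> \<and> x \<in> U \<and> y \<in> U" U] U xy by (auto simp: V_def)
    \<comment> \<open>Changing \<open>U\<close> to \<open>V\<close> adds \<open>c U V\<close> to the
      first term and \<open>c V U\<close> to the second; these cancel.\<close>
    have "c (A x) V = c (A x) U + c U V"
      using cocycle[of "A x" U V x] A'[OF U xy(1)] U V xy by simp
    moreover have "c V (A y) = c V U + c U (A y)"
      using cocycle[of V U "A y" y] A'[OF U xy(2)] U V xy by simp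
    ultimately show ?thesis
      using c_sym[of V U x] U V xy by (simp add: \<delta>_def V_def[symmetric])
  qed
  have "additive_on \<U> \<delta>"
    unfolding additive_on_def
  proof (intro ballI)
    fix U x y z assume "U \<in> \<U>" "x \<in> U" "y \<in> U" "z \<in> U"
    \<comment> \<open>The two middle terms \<open>c U (A y)\<close> and \<open>c (A y) U\<close>
      cancel.\<close>
    then show "\<delta> x y + \<delta> y z = \<delta> x z"
      using c_sym[of U "A y" y] A'[of U y] by (simp add: \<delta>)
  qed
  then obtain h where h: "\<And>U x y. U \<in> \<U> \<Longrightarrow> x \<in> U \<Longrightarrow> y \<in> U \<Longrightarrow> h y - h x = \<delta> x y"
    using simply_connected_primitive[OF assms(2,3), of \<delta>] assms(4) by metis
  \<comment> \<open>An empty member gets an arbitrary constant, which is harmless because zero is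
    its only test function.\<close>
  define C where "C U = (let x = SOME x. x \<in> U in h x + c (A x) U)" for U
  have C: "C U = h y + c (A y) U" if "U \<in> \<U>" "y \<in> U" for U y
  proof -
    define x where "x = (SOME x. x \<in> U)"
    have x: "x \<in> U" unfolding x_def using that(2) by (rule someI)
    have "h y = h x + (c (A x) U + c U (A y))"
      using h[OF that(1) x that(2)] \<delta>[OF that(1) x that(2)] by (simp add: algebra_simps)
    then show ?thesis
      using c_sym[of U "A y" y] A'[OF that] that by (simp add: C_def x_def[symmetric])
  qed
  define T where "T U = (\<lambda>\<phi>. F U \<phi> - const_distribution U (C U) \<phi>)" for U
  have T: "T U \<in> distributions U" if "U \<in> \<U>" for U
    unfolding T_def by (rule distribution_diff_const[OF assms(5)[OF that]])
  have "T U \<phi> = T V \<phi>" if UV: "U \<in> \<U>" "V \<in> \<U>" and \<phi>: "\<phi> \<in> test_functions (U \<inter> V)" for U V \<phi>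
  proof (cases "U \<inter> V = {}")
    case True
    then have "\<phi> = (\<lambda>x. 0)" using \<phi> not_in_supp[of _ \<phi>] by (auto simp: test_functions_def)
    then show ?thesis using distribution_zero[OF T] UV by simp
  next
    case False
    then obtain x where x: "x \<in> U" "x \<in> V" by blast
    \<comment> \<open>The terms \<open>h x\<close> cancel, and the cocycle rule for
      \<open>A x\<close>, \<open>U\<close>, \<open>V\<close> at the common point leaves
      \<open>c U V\<close>.\<close>
    have "C V - C U = c U V"
      using C[OF UV(1) x(1)] C[OF UV(2) x(2)] cocycle[of "A x" U V x] A'[OF UV(1) x(1)] UV x
      by (simp add: algebra_simps)
    then have "F V \<phi> - F U \<phi> = C V * (\<integral>x. \<phi> x \<partial>lborel) - C U * (\<integral>x. \<phi> x \<partial>lborel)"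
      using c[OF UV False \<phi>] by (simp add: left_diff_distrib[symmetric])
    moreover have "\<phi> \<in> test_functions U" "\<phi> \<in> test_functions V"
      using \<phi> by (auto simp: test_functions_def)
    ultimately show ?thesis
      by (simp add: T_def const_distribution_eq algebra_simps)
  qed
  then obtain G where "G \<in> distributions \<Omega>" "\<And>U \<phi>. U \<in> \<U> \<Longrightarrow> \<phi> \<in> test_functions U \<Longrightarrow> T U \<phi> = G \<phi>"
    using glue_distributions[of \<U> T] assms(3,4) T by metis
  then show ?thesis
    by (intro exI[of _ C] bexI[of _ G]) (auto simp: T_def algebra_simps)
qed

end
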